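(* The generating function of permutations with respect to the triple $(\mathsf{des},\mathsf{lmax},\mathsf{lmin})$, or equivalently $(\mathsf{ides},\mathsf{lmax},\mathsf{lmin})$, is $$\sum_{n=1}^{\infty}\sum_{\pi\in\mathfrak{S}_n}\frac{u^{\mathsf{des}(\pi)}z^{\mathsf{lmax}(\pi)}q^{\mathsf{lmin}(\pi)}t^n}{(1-u)^n}=\sum_{n=0}^{\infty}\frac{qzt\,u^n}{1-(n-q+1)t}\prod_{i=0}^{n}\frac{1-(i-q+1)t}{1-(i+z)t}.$$ In fact, for every $n\ge 1$, $(\mathsf{des},\mathsf{lmax},\mathsf{lmin},\mathsf{rmax})$ and $(\mathsf{ides},\mathsf{lmax},\mathsf{lmin},\mathsf{rmax})$ have the same distribution on $\mathfrak{S}_n$.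
   Context: $\mathfrak{S}_n$ is the set of permutations $\pi=\pi_1\pi_2\cdots\pi_n$ of $[n]=\{1,\dots,n\}$. $\mathsf{des}(\pi)=|\{i\in[n-1]:\pi_i>\pi_{i+1}\}|$; $\mathsf{ides}(\pi)=\mathsf{des}(\pi^{-1})$; $\mathsf{lmax}(\pi)=|\{\pi_i:\pi_i>\pi_j\text{ for all }j<i\}|$; $\mathsf{lmin}(\pi)=|\{\pi_i:\pi_i<\pi_j\text{ for all }j<i\}|$; $\mathsf{rmax}(\pi)=|\{\pi_i:\pi_i>\pi_j\text{ for all }j>i\}|$. Two tuples of statistics have the same distribution on a finite set if each tuple of values is attained by the same number of elements. The identity is one of formal power series in $u$ (with coefficients that are rational in $t$, expanded as power series in $t$). *)

theory Defs
  imports "HOL-Combinatorics.Permutations" "HOL-Computational_Algebra.Formal_Power_Series"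
begin

text \<open>
  A permutation of \<open>[n]\<close> is a function \<open>\<pi>\<close> with \<open>\<pi> permutes {1..n}\<close>; its one-line notation
  is \<open>\<pi> 1 \<pi> 2 \<dots> \<pi> n\<close>.  The length \<open>n\<close> is an explicit argument of every statistic, because
  \<open>\<pi>\<close> is a total function on \<open>nat\<close> and does not determine it.
\<close>

definition perms :: "nat \<Rightarrow> (nat \<Rightarrow> nat) set" where
  "perms n = {\<pi>. \<pi> permutes {1..n}}"

definition des :: "nat \<Rightarrow> (nat \<Rightarrow> nat) \<Rightarrow> nat" where
  "des n \<pi> = card {i \<in> {1..n - 1}. \<pi> i > \<pi> (i + 1)}"

definition ides :: "nat \<Rightarrow> (nat \<Rightarrow> nat) \<Rightarrow> nat" where
  "ides n \<pi> = des n (inv \<pi>)"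

definition lmax :: "nat \<Rightarrow> (nat \<Rightarrow> nat) \<Rightarrow> nat" where
  "lmax n \<pi> = card {\<pi> i | i. i \<in> {1..n} \<and> (\<forall>j \<in> {1..n}. j < i \<longrightarrow> \<pi> i > \<pi> j)}"

definition lmin :: "nat \<Rightarrow> (nat \<Rightarrow> nat) \<Rightarrow> nat" where
  "lmin n \<pi> = card {\<pi> i | i. i \<in> {1..n} \<and> (\<forall>j \<in> {1..n}. j < i \<longrightarrow> \<pi> i < \<pi> j)}"

definition rmax :: "nat \<Rightarrow> (nat \<Rightarrow> nat) \<Rightarrow> nat" where
  "rmax n \<pi> = card {\<pi> i | i. i \<in> {1..n} \<and> (\<forall>j \<in> {1..n}. j > i \<longrightarrow> \<pi> i > \<pi> j)}"

text \<open>To be used for finite \<open>S\<close> only, as \<open>card\<close> is \<open>0\<close> on infinite sets.\<close>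

definition same_distribution_on :: "'s set \<Rightarrow> ('s \<Rightarrow> 'v) \<Rightarrow> ('s \<Rightarrow> 'v) \<Rightarrow> bool" where
  "same_distribution_on S f g \<longleftrightarrow>
     (\<forall>v. card {x \<in> S. f x = v} = card {x \<in> S. g x = v})"

text \<open>
  An element of \<open>'a fps fps\<close> is a power series in the outer variable \<open>u\<close> whose coefficients are
  power series in the inner variable \<open>t\<close>: \<open>u\<close> is \<open>fps_X\<close>, \<open>t\<close> is \<open>fps_const fps_X\<close>, and a
  scalar \<open>c\<close> is \<open>fps_const (fps_const c)\<close>.

  A family of such series has a formal sum iff each monomial \<open>u\<^sup>i t\<^sup>j\<close> occurs in only finitely many
  of its members, and the sum is then taken coefficientwise.  The convergence of the \<open>fps\<close> library
  is unsuitable here: it is the adic one for the outer variable with discrete coefficients, in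
  which \<open>\<Sum>n. t\<^sup>n / (1 - u)\<^sup>n\<close> diverges.
\<close>

definition has_formal_sum ::
    "(nat \<Rightarrow> 'a::comm_monoid_add fps fps) \<Rightarrow> nat set \<Rightarrow> 'a fps fps \<Rightarrow> bool" where
  "has_formal_sum f A F \<longleftrightarrow>
     (\<forall>i j. finite {n \<in> A. fps_nth (fps_nth (f n) i) j \<noteq> 0} \<and>
        fps_nth (fps_nth F i) j =
          (\<Sum>n \<in> {n \<in> A. fps_nth (fps_nth (f n) i) j \<noteq> 0}. fps_nth (fps_nth (f n) i) j))"

end

theory Submission
  imports Defs "HOL-Computational_Algebra.Polynomial"
begin

text \<open>
  Reading the values of a permutation through a weakly increasing labelling \<open>b\<close> that is strict at
  the inverse descents gives a word \<open>w\<^sub>i = b(\<pi>\<^sub>i)\<close>, and every word arises exactly once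
  (\<open>\<pi>\<close> is its standardization).  Weak left-to-right maxima, strict left-to-right minima and strict
  right-to-left maxima of \<open>w\<close> are those of \<open>\<pi>\<close>, so the joint distribution of
  \<open>(ides, lmax, lmin, rmax)\<close> is determined by the weighted word counts over \<open>{0..<k}\<close> for all \<open>k\<close>.

  The words with minimum \<open>m\<close> and maximum \<open>M\<close> have, without \<open>rmax\<close>, a weight that depends only on
  their length and \<open>M - m\<close>; adding the last letter gives a first-order recurrence whose solution is
  the product in the formula.

  The reflection in the antidiagonal exchanges \<open>lmin\<close> and \<open>rmax\<close>, keeps \<open>lmax\<close> and turns
  \<open>ides\<close> into \<open>des\<close>.  Hence the equidistribution says that the word series is symmetric in the
  variables \<open>q\<close> of \<open>lmin\<close> and \<open>r\<close> of \<open>rmax\<close>.  Cut a word at the last occurrence of its maximum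
  \<open>k\<close>; the two parts interact only through the minimum \<open>m\<close> of the first part, whose series is
  \<open>q \<Prod>\<^sub>j (1 + (q - j) t)\<close>, \<open>1 \<le> j \<le> k - m\<close>, times a factor free of \<open>q\<close> and \<open>r\<close>.  The product
  of \<open>\<Prod>\<^sub>j (1 + (q - j) t)\<close> and the series of the second part satisfies a recurrence in \<open>k\<close> and
  \<open>m\<close> whose coefficients are symmetric in \<open>q\<close> and \<open>r\<close>.
\<close>

section \<open>Words and the part after the last maximum\<close>

definition words :: "nat \<Rightarrow> nat \<Rightarrow> nat list set" where
  "words n k = {w. length w = n \<and> set w \<subseteq> {..<k}}"

text \<open>
  The first argument of \<open>lr_min\<close> and \<open>lr_max\<close> is the current record: only letters beyond it
  count, strictly for minima and weakly for maxima.
\<close>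

primrec lr_min :: "nat \<Rightarrow> nat list \<Rightarrow> nat" where
  "lr_min m [] = 0"
| "lr_min m (x # xs) = (if x < m then Suc (lr_min x xs) else lr_min m xs)"

primrec lr_max :: "nat \<Rightarrow> nat list \<Rightarrow> nat" where
  "lr_max m [] = 0"
| "lr_max m (x # xs) = (if m \<le> x then Suc (lr_max x xs) else lr_max m xs)"

primrec rl_max :: "nat list \<Rightarrow> nat" where
  "rl_max [] = 0"
| "rl_max (x # xs) = (if \<forall>y\<in>set xs. y < x then Suc (rl_max xs) else rl_max xs)"

lemma finite_words [simp]: "finite (words n k)"
  using finite_lists_length_eq[of "{..<k}" n] by (simp add: words_def conj_commute)

lemma words_0 [simp]: "words 0 k = {[]}"
  by (auto simp: words_def)

lemma sum_words_Suc:
  "(\<Sum>w\<in>words (Suc n) k. f w) = (\<Sum>x<k. \<Sum>w\<in>words n k. f (x # w))"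
proof -
  have "words (Suc n) k = (\<lambda>(x, w). x # w) ` ({..<k} \<times> words n k)"
    by (force simp: words_def length_Suc_conv)
  moreover have "inj_on (\<lambda>(x, w). x # w) ({..<k} \<times> words n k)"
    by (auto simp: inj_on_def)
  ultimately show ?thesis
    by (simp add: sum.reindex sum.cartesian_product case_prod_unfold)
qed

lemma sum_words_Suc_snoc:
  "(\<Sum>w\<in>words (Suc n) k. f w) = (\<Sum>w\<in>words n k. \<Sum>x<k. f (w @ [x]))"
proof -
  have "words (Suc n) k = (\<lambda>(w, x). w @ [x]) ` (words n k \<times> {..<k})"
    by (force simp: words_def length_Suc_conv_rev)
  moreover have "inj_on (\<lambda>(w, x). w @ [x]) (words n k \<times> {..<k})"
    by (auto simp: inj_on_def)
  ultimately show ?thesis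
    by (simp add: sum.reindex sum.cartesian_product case_prod_unfold)
qed

lemma words_Suc_letter:
  "words n (Suc k) = words n k \<union> {w \<in> words n (Suc k). k \<in> set w}"
  by (auto simp: words_def less_Suc_eq)

lemma sum_words_Suc_letter:
  "(\<Sum>w\<in>words n (Suc k). f w)
    = (\<Sum>w\<in>words n k. f w) + (\<Sum>w\<in>{w \<in> words n (Suc k). k \<in> set w}. f w)"
proof -
  have "words n k \<inter> {w \<in> words n (Suc k). k \<in> set w} = {}"
    by (auto simp: words_def)
  then show ?thesis
    by (subst words_Suc_letter) (simp add: sum.union_disjoint)
qed

text \<open>The first letter becomes the record under any start above all letters, so the alphabet
  bound is a neutral starting value.\<close>

lemma lr_min_bound:
  "\<lbrakk>set w \<subseteq> {..<k}; k \<le> m\<rbrakk> \<Longrightarrow> lr_min m w = lr_min k w"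
  by (cases w) (auto simp: subset_iff)

context
  fixes q r :: "'a::field"
begin

text \<open>
  The variable is \<open>t\<close>, marking the length.  \<open>tail_fps k m\<close> is the series of the words that can follow the
  last occurrence of the maximum \<open>k\<close> when the minimum so far is \<open>m\<close>.
\<close>

definition tail_fps :: "nat \<Rightarrow> nat \<Rightarrow> 'a fps" where
  "tail_fps k m = Abs_fps (\<lambda>n. \<Sum>w\<in>words n k. q ^ lr_min m w * r ^ rl_max w)"

text \<open>The increment from \<open>tail_fps k m\<close> to \<open>tail_fps (Suc k) m\<close>; a
  linear system in \<open>m\<close> for it yields the recurrences in \<open>k\<close>.\<close>

definition top_fps :: "nat \<Rightarrow> nat \<Rightarrow> 'a fps" where
  "top_fps k m = Abs_fps (\<lambda>n. \<Sum>w\<in>{w \<in> words n (Suc k). k \<in> set w}.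
     q ^ lr_min m w * r ^ rl_max w)"

lemma tail_fps_Suc: "tail_fps (Suc k) m = tail_fps k m + top_fps k m"
  by (simp add: fps_eq_iff tail_fps_def top_fps_def sum_words_Suc_letter)

lemma tail_fps_bound: "tail_fps k (Suc k) = tail_fps k k"
  by (auto simp: fps_eq_iff tail_fps_def words_def lr_min_bound[of _ k "Suc k"] intro!: sum.cong)

lemma tail_fps_0: "tail_fps 0 m = 1"
proof -
  have "words n 0 = (if n = 0 then {[]} else {})" for n
    by (auto simp: words_def)
  then show ?thesis
    by (auto simp: fps_eq_iff tail_fps_def)
qed

lemma top_fps_nth_0: "fps_nth (top_fps k m) 0 = 0"
proof -
  have "{w \<in> words 0 (Suc k). k \<in> set w} = {}" by auto
  then show ?thesis unfolding top_fps_def by (simp only: fps_nth_Abs_fps sum.empty)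
qed

text \<open>
  If the remaining word still contains the top letter \<open>k\<close>, then the first letter is no right-to-left
  maximum; otherwise the first letter is \<open>k\<close> and is one.
\<close>

lemma top_fps_nth_Suc:
  "fps_nth (top_fps k m) (Suc n) =
     (\<Sum>x\<le>k. (if x < m then q else 1) * fps_nth (top_fps k (min m x)) n)
     + (if k < m then q else 1) * r * fps_nth (tail_fps k (min m k)) n"
proof -
  let ?g = "\<lambda>m w. q ^ lr_min m w * r ^ rl_max w"
  let ?T = "{w \<in> words n (Suc k). k \<in> set w}"
  have "fps_nth (top_fps k m) (Suc n)
      = (\<Sum>w\<in>words (Suc n) (Suc k). if k \<in> set w then ?g m w else 0)"
    by (simp add: top_fps_def sum.inter_filter)
  also have "\<dots> = (\<Sum>x\<le>k. \<Sum>w\<in>words n (Suc k). if k \<in> set (x # w) then ?g m (x # w) else 0)"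
    by (simp only: sum_words_Suc lessThan_Suc_atMost)
  also have "\<dots> = (\<Sum>x\<le>k. (\<Sum>w\<in>?T. ?g m (x # w))
      + (if x = k then \<Sum>w\<in>words n k. ?g m (k # w) else 0))"
    by (rule sum.cong[OF refl], subst sum_words_Suc_letter)
      (auto simp: words_def intro!: sum.cong sum.neutral)
  also have "\<dots> = (\<Sum>x\<le>k. (if x < m then q else 1) * (\<Sum>w\<in>?T. ?g (min m x) w))
      + (\<Sum>w\<in>words n k. ?g m (k # w))"
  proof -
    have "(\<Sum>w\<in>?T. ?g m (x # w)) = (if x < m then q else 1) * (\<Sum>w\<in>?T. ?g (min m x) w)"
      if "x \<le> k" for x
      unfolding sum_distrib_left
      using that by (intro sum.cong) (auto simp: min_def)
    then show ?thesis by (simp add: sum.distrib)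
  qed
  also have "(\<Sum>w\<in>words n k. ?g m (k # w))
      = (if k < m then q else 1) * r * (\<Sum>w\<in>words n k. ?g (min m k) w)"
    unfolding sum_distrib_left
    by (intro sum.cong) (auto simp: words_def min_def)
  finally show ?thesis by (simp add: top_fps_def tail_fps_def)
qed

text \<open>First-letter analysis: the \<open>Suc k - m\<close> letters from \<open>m\<close> to
  \<open>k\<close> keep the record, a letter \<open>x < m\<close> earns \<open>q\<close> and becomes
  the record, and the last term is the case where the first letter is the only
  \<open>k\<close>.\<close>

lemma top_fps_eq:
  assumes "m \<le> k"
  shows "top_fps k m = fps_X * (of_nat (Suc k - m) * top_fps k m
    + fps_const q * (\<Sum>x<m. top_fps k x) + fps_const r * tail_fps k m)"
proof (rule fps_ext)
  fix n
  show "fps_nth (top_fps k m) n = fps_nth (fps_X * (of_nat (Suc k - m) * top_fps k m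
    + fps_const q * (\<Sum>x<m. top_fps k x) + fps_const r * tail_fps k m)) n"
  proof (cases n)
    case 0
    then show ?thesis by (simp add: top_fps_nth_0)
  next
    case (Suc n')
    have split: "{..k} = {..<m} \<union> {m..k}" using assms by auto
    have "(\<Sum>x\<le>k. (if x < m then q else 1) * fps_nth (top_fps k (min m x)) n')
      = (\<Sum>x<m. q * fps_nth (top_fps k x) n') + (\<Sum>x=m..k. fps_nth (top_fps k m) n')"
    proof -
      have "(\<Sum>x<m. (if x < m then q else 1) * fps_nth (top_fps k (min m x)) n')
          = (\<Sum>x<m. q * fps_nth (top_fps k x) n')"
        by (rule sum.cong) (auto simp: min_def)
      moreover have "(\<Sum>x=m..k. (if x < m then q else 1) * fps_nth (top_fps k (min m x)) n')
          = (\<Sum>x=m..k. fps_nth (top_fps k m) n')"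
        by (rule sum.cong) (auto simp: min_def)
      moreover have "{..<m} \<inter> {m..k} = {}" by auto
      ultimately show ?thesis
        unfolding split by (simp only: sum.union_disjoint finite_lessThan finite_atLeastAtMost)
    qed
    with Suc assms show ?thesis
      by (simp add: top_fps_nth_Suc sum_distrib_left fps_sum_nth min_def flip: fps_of_nat)
  qed
qed

text \<open>Started at \<open>Suc k\<close>, every first letter is a new minimum, even
  \<open>k\<close>, so all terms carry \<open>q\<close>.\<close>

lemma top_fps_Suc_eq:
  "top_fps k (Suc k) = fps_X * fps_const q * ((\<Sum>x\<le>k. top_fps k x) + fps_const r * tail_fps k k)"
proof (rule fps_ext)
  fix n
  show "fps_nth (top_fps k (Suc k)) n = fps_nth (fps_X * fps_const q *
    ((\<Sum>x\<le>k. top_fps k x) + fps_const r * tail_fps k k)) n"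
  proof (cases n)
    case 0
    then show ?thesis by (simp add: top_fps_nth_0)
  next
    case (Suc n')
    have "(\<Sum>x\<le>k. (if x < Suc k then q else 1) * fps_nth (top_fps k (min (Suc k) x)) n')
      = (\<Sum>x\<le>k. q * fps_nth (top_fps k x) n')"
      by (rule sum.cong) (auto simp: min_def)
    with Suc show ?thesis
      by (simp add: top_fps_nth_Suc mult.assoc fps_sum_nth sum_distrib_left distrib_left)
  qed
qed

text \<open>Subtracting \<open>top_fps_eq\<close> at \<open>m\<close> from its instance at
  \<open>Suc m\<close> removes the sum over lower records.\<close>

lemma top_fps_step:
  assumes "Suc m \<le> k"
  shows "(1 - of_nat (k - m) * fps_X) * top_fps k (Suc m)
    = (1 - (of_nat (Suc (k - m)) - fps_const q) * fps_X) * top_fps k m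
      + fps_const r * fps_X * (tail_fps k (Suc m) - tail_fps k m)"
proof -
  have 1: "top_fps k (Suc m) = fps_X * (of_nat (k - m) * top_fps k (Suc m)
    + fps_const q * ((\<Sum>x<m. top_fps k x) + top_fps k m) + fps_const r * tail_fps k (Suc m))"
    using top_fps_eq[OF assms] by simp
  have 2: "top_fps k m = fps_X * (of_nat (Suc (k - m)) * top_fps k m
    + fps_const q * (\<Sum>x<m. top_fps k x) + fps_const r * tail_fps k m)"
    using top_fps_eq[of m k] assms by (simp add: Suc_diff_le)
  from 1 2 show ?thesis by algebra
qed

lemma top_fps_first: "(1 - of_nat (Suc k) * fps_X) * top_fps k 0 = fps_const r * fps_X * tail_fps k 0"
  using top_fps_eq[of 0 k] by simp algebra

text \<open>The same elimination, now between \<open>top_fps_eq\<close> at \<open>m = k\<close> and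
  \<open>top_fps_Suc_eq\<close>.\<close>

lemma top_fps_last:
  "top_fps k (Suc k) = (1 + fps_const (q - 1) * fps_X) * top_fps k k
     + fps_const ((q - 1) * r) * fps_X * tail_fps k k"
proof -
  have 1: "top_fps k k = fps_X * (top_fps k k
    + fps_const q * (\<Sum>x<k. top_fps k x) + fps_const r * tail_fps k k)"
    using top_fps_eq[of k k] by simp
  have 2: "top_fps k (Suc k) = fps_X * fps_const q *
    ((\<Sum>x<k. top_fps k x) + top_fps k k + fps_const r * tail_fps k k)"
    using top_fps_Suc_eq[of k] by (simp flip: lessThan_Suc_atMost)
  have 3: "fps_const (q - 1) = fps_const q - 1" "fps_const ((q - 1) * r) = (fps_const q - 1) * fps_const r"
    by (simp_all flip: fps_const_mult fps_const_sub)
  from 1 2 show ?thesis unfolding 3 by algebra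
qed

end

section \<open>The normalized tail series and its symmetry\<close>

definition shift_prod :: "'a::field \<Rightarrow> nat \<Rightarrow> 'a fps" where
  "shift_prod q l = (\<Prod>j=1..l. 1 + fps_const (q - of_nat j) * fps_X)"

lemma shift_prod_0 [simp]: "shift_prod q 0 = 1"
  by (simp add: shift_prod_def)

lemma shift_prod_Suc:
  "shift_prod q (Suc l) = shift_prod q l * (1 + (fps_const q - of_nat (Suc l)) * fps_X)"
  by (simp add: shift_prod_def flip: fps_of_nat fps_const_sub)

definition sym_tail :: "'a::field \<Rightarrow> 'a \<Rightarrow> nat \<Rightarrow> nat \<Rightarrow> 'a fps" where
  "sym_tail q r k m = shift_prod q (k - m) * tail_fps q r k m"

text \<open>Written in tails alone, \<open>top_fps_step\<close> has the factor
  \<open>1 + (fps_const r - l) * fps_X\<close> on \<open>tail_fps q r k (Suc m)\<close>. Multiplying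
  by \<open>shift_prod q (k - m)\<close> adds the same factor with \<open>q\<close> there, and the
  leftover factor of \<open>tail_fps q r (Suc k) m\<close> is exactly what its own normalization
  needs.\<close>

lemma sym_tail_step:
  assumes "Suc m \<le> k"
  defines "l \<equiv> of_nat (k - m) :: 'a::field fps"
  shows "(1 - l * fps_X) * sym_tail q r (Suc k) (Suc m)
    = (1 + (fps_const q - l) * fps_X) * (1 + (fps_const r - l) * fps_X) * sym_tail q r k (Suc m)
      + sym_tail q r (Suc k) m
      - (1 + (fps_const q + fps_const r - l - 1) * fps_X) * sym_tail q r k m"
proof -
  obtain d where d: "k - m = Suc d" using assms by (cases "k - m") auto
  then have d': "k - Suc m = d" "Suc k - m = Suc (Suc d)" by auto
  have l: "l = of_nat (Suc d)" by (simp add: l_def d)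
  have 1: "(1 - l * fps_X) * top_fps q r k (Suc m)
    = (1 - (l + 1 - fps_const q) * fps_X) * top_fps q r k m
      + fps_const r * fps_X * (tail_fps q r k (Suc m) - tail_fps q r k m)"
    using top_fps_step[OF assms(1), of q r] by (simp add: l_def add.commute)
  have 2: "sym_tail q r (Suc k) (Suc m) =
      shift_prod q d * (1 + (fps_const q - l) * fps_X) * (tail_fps q r k (Suc m) + top_fps q r k (Suc m))"
    "sym_tail q r (Suc k) m =
      shift_prod q d * (1 + (fps_const q - l) * fps_X) * (1 + (fps_const q - (l + 1)) * fps_X)
       * (tail_fps q r k m + top_fps q r k m)"
    "sym_tail q r k (Suc m) = shift_prod q d * tail_fps q r k (Suc m)"
    "sym_tail q r k m = shift_prod q d * (1 + (fps_const q - l) * fps_X) * tail_fps q r k m"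
    by (simp_all add: sym_tail_def d d' shift_prod_Suc tail_fps_Suc l add.commute)
  show ?thesis unfolding 2 using 1 by algebra
qed

lemma sym_tail_first:
  fixes k :: nat
  defines "l \<equiv> of_nat (Suc k) :: 'a::field fps"
  shows "(1 - l * fps_X) * sym_tail q r (Suc k) 0
    = (1 + (fps_const q - l) * fps_X) * (1 + (fps_const r - l) * fps_X) * sym_tail q r k 0"
proof -
  have 1: "(1 - l * fps_X) * top_fps q r k 0 = fps_const r * fps_X * tail_fps q r k 0"
    unfolding l_def by (rule top_fps_first)
  have 2: "sym_tail q r (Suc k) 0 =
      shift_prod q k * (1 + (fps_const q - l) * fps_X) * (tail_fps q r k 0 + top_fps q r k 0)"
    by (simp add: sym_tail_def shift_prod_Suc tail_fps_Suc l_def)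
  have 3: "sym_tail q r k 0 = shift_prod q k * tail_fps q r k 0"
    by (simp add: sym_tail_def)
  show ?thesis unfolding 2 3 using 1 by algebra
qed

text \<open>Supplies the diagonal entry, which \<open>sym_tail_step\<close> does not reach because
  it needs \<open>Suc m <= k\<close>.\<close>

lemma sym_tail_last:
  fixes q r :: "'a::field"
  shows "sym_tail q r (Suc k) (Suc k) = sym_tail q r (Suc k) k
     + (fps_const q - 1) * (fps_const r - 1) * fps_X * sym_tail q r k k"
proof -
  have 1: "top_fps q r k (Suc k) = (1 + (fps_const q - 1) * fps_X) * top_fps q r k k
     + (fps_const q - 1) * fps_const r * fps_X * tail_fps q r k k"
    using top_fps_last[of q r k] by (simp flip: fps_const_mult fps_const_sub)
  have 2: "sym_tail q r (Suc k) k =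
      (1 + (fps_const q - 1) * fps_X) * (tail_fps q r k k + top_fps q r k k)"
    by (simp add: sym_tail_def shift_prod_Suc tail_fps_Suc)
  have 3: "sym_tail q r (Suc k) (Suc k) = tail_fps q r k k + top_fps q r k (Suc k)"
    "sym_tail q r k k = tail_fps q r k k"
    by (simp_all add: sym_tail_def tail_fps_Suc tail_fps_bound)
  show ?thesis unfolding 2 3 1 by algebra
qed

lemma one_minus_fps_X_cancel:
  fixes c :: "'a::field fps"
  assumes "(1 - c * fps_X) * f = (1 - c * fps_X) * g"
  shows "f = g"
proof -
  have "fps_nth (1 - c * fps_X) 0 = 1" by simp
  then have "1 - c * fps_X \<noteq> 0" by force
  with assms show ?thesis by simp
qed

lemma sym_tail_commute: "m \<le> k \<Longrightarrow> sym_tail q r k m = sym_tail r q k m"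
proof (induction k arbitrary: m)
  case 0
  then show ?case by (simp add: sym_tail_def tail_fps_0)
next
  case (Suc k)
  note IH = Suc.IH
  \<comment> \<open>Row \<open>Suc k\<close> is filled from \<open>m = 0\<close> upwards and the
    diagonal comes last. Each recurrence is unchanged by exchanging \<open>q\<close> and
    \<open>r\<close> and uses only entries already known to be symmetric.\<close>
  have *: "sym_tail q r (Suc k) m = sym_tail r q (Suc k) m" if "m \<le> k" for m
    using that
  proof (induction m)
    case 0
    show ?case
      by (rule one_minus_fps_X_cancel[of "of_nat (Suc k)"])
        (simp only: sym_tail_first IH[of 0] mult.commute[of "1 + (fps_const q - of_nat (Suc k)) * fps_X"] le0)
  next
    case (Suc m)
    then have m: "Suc m \<le> k" "m \<le> k" by simp_all
    show ?case
      by (rule one_minus_fps_X_cancel[of "of_nat (k - m)"])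
        (simp only: sym_tail_step[OF m(1)] Suc.IH[OF m(2)] IH[OF m(1)] IH[OF m(2)]
          mult.commute[of "1 + (fps_const q - of_nat (k - m)) * fps_X"]
          add.commute[of "fps_const q"])
  qed
  show ?case
  proof (cases "m = Suc k")
    case True
    show ?thesis
      unfolding True
      using sym_tail_last[of q r k] sym_tail_last[of r q k] *[OF order_refl] IH[OF order_refl] by algebra
  next
    case False
    with Suc.prems * show ?thesis by simp
  qed
qed

section \<open>The part before the last maximum\<close>

lemma lr_min_append: "lr_min m (u @ v) = lr_min m u + lr_min (fold min u m) v"
  by (induction u arbitrary: m) (auto simp: min_def)

lemma lr_max_append: "lr_max m (u @ v) = lr_max m u + lr_max (fold max u m) v"
  by (induction u arbitrary: m) (auto simp: max_def)

lemma fold_min_eq_Min: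
  assumes "u \<noteq> []" "set u \<subseteq> {..m}"
  shows "fold min u m = Min (set u)"
proof -
  have "fold min u m = Min (insert m (set u))"
    using Min.set_eq_fold[of m u] by simp
  also have "\<dots> = min m (Min (set u))"
    using assms by (subst Min_insert) auto
  also have "\<dots> = Min (set u)"
  proof (rule min_absorb2)
    have "Min (set u) \<in> set u" using assms by (intro Min_in) auto
    with assms(2) have "Min (set u) \<in> {..m}" by blast
    then show "Min (set u) \<le> m" by (simp only: atMost_iff)
  qed
  finally show ?thesis .
qed

lemma fold_max_eq_Max:
  assumes "u \<noteq> []"
  shows "fold max u 0 = Max (set u :: nat set)"
proof -
  have "fold max u 0 = Max (insert 0 (set u))"
    using Max.set_eq_fold[of 0 u] by simp
  also have "\<dots> = Max (set u)"
    using assms by (subst Max_insert) auto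
  finally show ?thesis .
qed

lemma in_words_Suc_D:
  assumes "w \<in> words (Suc n) k"
  shows "w \<noteq> []" "Min (set w) \<le> Max (set w)" "Max (set w) < k" "set w \<subseteq> {..k}"
proof -
  show w: "w \<noteq> []" "set w \<subseteq> {..k}"
    using assms by (auto simp: words_def)
  then show "Min (set w) \<le> Max (set w)" by simp
  show "Max (set w) < k"
    using assms w Max_in[of "set w"] by (auto simp: words_def)
qed

text \<open>
  \<open>span_wt z q n l\<close> is the weight of the words of length \<open>n + 1\<close> (not \<open>n\<close>) whose maximum and minimum
  differ by \<open>l\<close>, both being prescribed.
\<close>

primrec span_wt :: "'a::field \<Rightarrow> 'a \<Rightarrow> nat \<Rightarrow> nat \<Rightarrow> 'a" where
  "span_wt z q 0 l = (if l = 0 then z * q else 0)"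
| "span_wt z q (Suc n) l = (of_nat l + z) * span_wt z q n l + (z + q) * (\<Sum>j<l. span_wt z q n j)"

text \<open>\<open>a\<close> and \<open>b\<close> are the extremes so far and \<open>x\<close> is
  the new last letter. A letter in \<open>{a..<b}\<close> is no record, a letter
  \<open>x >= b\<close> must equal \<open>M\<close>, and a letter \<open>x < a\<close> must equal
  \<open>m\<close>.\<close>

lemma sum_last_letter:
  fixes z q :: "'a::field"
  assumes "a \<le> b" "b < k" "m \<le> M" "M < k"
  shows "(\<Sum>x<k. if min a x = m \<and> max b x = M
            then (if b \<le> x then z else 1) * (if x < a then q else 1) else 0)
    = (if a = m \<and> b = M then of_nat (M - m) else 0)
      + (if a = m \<and> b \<le> M then z else 0) + (if b = M \<and> m < a then q else 0)"
proof -
  have "(\<Sum>x<k. if min a x = m \<and> max b x = M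
            then (if b \<le> x then z else 1) * (if x < a then q else 1) else 0)
    = (\<Sum>x<k. (if a \<le> x \<and> x < b then if a = m \<and> b = M then 1 else 0 else 0)
        + (if x = M then if a = m \<and> b \<le> M then z else 0 else 0)
        + (if x = m then if b = M \<and> m < a then q else 0 else 0))"
    using assms by (intro sum.cong refl) (auto simp: min_def max_def)
  also have "\<dots> = (\<Sum>x\<in>{x \<in> {..<k}. a \<le> x \<and> x < b}. if a = m \<and> b = M then 1 else 0)
      + (if a = m \<and> b \<le> M then z else 0) + (if b = M \<and> m < a then q else 0)"
    using assms by (simp add: sum.distrib flip: sum.inter_filter)
  also have "{x \<in> {..<k}. a \<le> x \<and> x < b} = {a..<b}"
    using assms by auto
  finally show ?thesis by simp
qed

context
  fixes z q :: "'a::field"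
begin

text \<open>No \<open>r\<close>: before the last maximum no letter is a right-to-left maximum. For
  letters below \<open>k\<close>, the starts 0 and \<open>k\<close> make the first letter count as
  both kinds of record.\<close>

definition head_wt :: "nat \<Rightarrow> nat list \<Rightarrow> 'a" where
  "head_wt k w = z ^ lr_max 0 w * q ^ lr_min k w"

lemma head_wt_snoc:
  assumes "w \<in> words (Suc n) k"
  shows "head_wt k (w @ [x]) = head_wt k w *
    ((if Max (set w) \<le> x then z else 1) * (if x < Min (set w) then q else 1))"
  using fold_min_eq_Min[of w k] fold_max_eq_Max[of w] in_words_Suc_D[OF assms]
  by (simp add: head_wt_def lr_min_append lr_max_append)

lemma sum_words_span:
  assumes "m \<le> M" "M < k"
  shows "(\<Sum>w\<in>words (Suc n) k. if Min (set w) = m \<and> Max (set w) = M then head_wt k w else 0)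
    = span_wt z q n (M - m)"
  using assms
proof (induction n arbitrary: m M)
  case 0
  have "(\<Sum>w\<in>words (Suc 0) k. if Min (set w) = m \<and> Max (set w) = M then head_wt k w else 0)
    = (\<Sum>x<k. if x = m then if m = M then z * q else 0 else 0)"
    by (simp only: sum_words_Suc words_0) (intro sum.cong refl, auto simp: head_wt_def)
  with 0 show ?case by auto
next
  case (Suc n)
  let ?P = "\<lambda>m M. \<Sum>w\<in>words (Suc n) k. if Min (set w) = m \<and> Max (set w) = M then head_wt k w else 0"
  have "(\<Sum>w\<in>words (Suc (Suc n)) k. if Min (set w) = m \<and> Max (set w) = M then head_wt k w else 0)
    = (\<Sum>w\<in>words (Suc n) k. head_wt k w * (\<Sum>x<k.
        if min (Min (set w)) x = m \<and> max (Max (set w)) x = M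
        then (if Max (set w) \<le> x then z else 1) * (if x < Min (set w) then q else 1) else 0))"
    unfolding sum_words_Suc_snoc[where n = "Suc n"] sum_distrib_left
  proof (intro sum.cong refl)
    fix w x assume "w \<in> words (Suc n) k"
    moreover from this have "Min (set (w @ [x])) = min (Min (set w)) x"
      "Max (set (w @ [x])) = max (Max (set w)) x"
      by (auto simp: in_words_Suc_D min.commute max.commute)
    ultimately show "(if Min (set (w @ [x])) = m \<and> Max (set (w @ [x])) = M
        then head_wt k (w @ [x]) else 0) =
      head_wt k w * (if min (Min (set w)) x = m \<and> max (Max (set w)) x = M
        then (if Max (set w) \<le> x then z else 1) * (if x < Min (set w) then q else 1) else 0)"
      by (simp only: head_wt_snoc mult_zero_right split: if_splits) auto
  qed
  also have "\<dots> = (\<Sum>w\<in>words (Suc n) k. head_wt k w *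
        ((if Min (set w) = m \<and> Max (set w) = M then of_nat (M - m) else 0)
      + (if Min (set w) = m \<and> Max (set w) \<le> M then z else 0)
      + (if Max (set w) = M \<and> m < Min (set w) then q else 0)))"
    using Suc.prems by (intro sum.cong refl) (simp only: sum_last_letter in_words_Suc_D)
  \<comment> \<open>The inequalities on \<open>Min\<close> and \<open>Max\<close> are resolved into
    exact values, so that the induction hypothesis applies to each term.\<close>
  also have "\<dots> = (\<Sum>w\<in>words (Suc n) k.
        of_nat (M - m) * (if Min (set w) = m \<and> Max (set w) = M then head_wt k w else 0)
      + z * (\<Sum>b=m..M. if Min (set w) = m \<and> Max (set w) = b then head_wt k w else 0)
      + q * (\<Sum>a=Suc m..M. if Min (set w) = a \<and> Max (set w) = M then head_wt k w else 0))"
  proof (intro sum.cong refl)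
    fix w assume "w \<in> words (Suc n) k"
    note w = in_words_Suc_D[OF this]
    have "(\<Sum>b=m..M. if Min (set w) = m \<and> Max (set w) = b then head_wt k w else 0)
      = (\<Sum>b=m..M. if b = Max (set w) then if Min (set w) = m then head_wt k w else 0 else 0)"
      by (intro sum.cong) auto
    also have "\<dots> = (if Min (set w) = m \<and> Max (set w) \<le> M then head_wt k w else 0)"
      using w(2) by auto
    finally have 1: "(\<Sum>b=m..M. if Min (set w) = m \<and> Max (set w) = b then head_wt k w else 0)
      = (if Min (set w) = m \<and> Max (set w) \<le> M then head_wt k w else 0)" .
    have "(\<Sum>a=Suc m..M. if Min (set w) = a \<and> Max (set w) = M then head_wt k w else 0)
      = (\<Sum>a=Suc m..M. if a = Min (set w) then if Max (set w) = M then head_wt k w else 0 else 0)"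
      by (intro sum.cong) auto
    also have "\<dots> = (if Max (set w) = M \<and> m < Min (set w) then head_wt k w else 0)"
      using w(2) by auto
    finally have 2: "(\<Sum>a=Suc m..M. if Min (set w) = a \<and> Max (set w) = M then head_wt k w else 0)
      = (if Max (set w) = M \<and> m < Min (set w) then head_wt k w else 0)" .
    show "head_wt k w *
        ((if Min (set w) = m \<and> Max (set w) = M then of_nat (M - m) else 0)
      + (if Min (set w) = m \<and> Max (set w) \<le> M then z else 0)
      + (if Max (set w) = M \<and> m < Min (set w) then q else 0)) =
      of_nat (M - m) * (if Min (set w) = m \<and> Max (set w) = M then head_wt k w else 0)
      + z * (\<Sum>b=m..M. if Min (set w) = m \<and> Max (set w) = b then head_wt k w else 0)
      + q * (\<Sum>a=Suc m..M. if Min (set w) = a \<and> Max (set w) = M then head_wt k w else 0)"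
      unfolding 1 2 by (simp add: algebra_simps)
  qed
  also have "\<dots> = of_nat (M - m) * ?P m M + z * (\<Sum>b=m..M. ?P m b) + q * (\<Sum>a=Suc m..M. ?P a M)"
    by (simp only: sum.distrib sum_distrib_left sum.swap[of _ "words (Suc n) k"])
  \<comment> \<open>Here \<open>b = M\<close> is allowed, whereas the sum over \<open>a\<close>
    below excludes \<open>m\<close>; hence \<open>z\<close> alone joins \<open>of_nat l\<close> in
    \<open>span_wt\<close>.\<close>
  also have "(\<Sum>b=m..M. ?P m b) = (\<Sum>b=m..M. span_wt z q n (b - m))"
    using Suc by (intro sum.cong) auto
  also have "\<dots> = (\<Sum>j\<le>M - m. span_wt z q n j)"
    using Suc.prems by (intro sum.reindex_bij_witness[of _ "\<lambda>j. j + m" "\<lambda>b. b - m"]) auto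
  also have "(\<Sum>a=Suc m..M. ?P a M) = (\<Sum>a=Suc m..M. span_wt z q n (M - a))"
    using Suc by (intro sum.cong) auto
  also have "\<dots> = (\<Sum>j<M - m. span_wt z q n j)"
    using Suc.prems by (intro sum.reindex_bij_witness[of _ "\<lambda>j. M - j" "\<lambda>a. M - a"]) auto
  also have "?P m M = span_wt z q n (M - m)"
    using Suc by blast
  finally show ?case
    by (simp add: algebra_simps flip: lessThan_Suc_atMost)
qed

text \<open>By \<open>sum_words_Min\<close>, the weight of the words of length \<open>n + 1\<close>
  with prescribed minimum whose maximum exceeds it by at most \<open>l\<close>.\<close>

definition span_sum :: "nat \<Rightarrow> nat \<Rightarrow> 'a" where
  "span_sum n l = (\<Sum>j\<le>l. span_wt z q n j)"

lemma sum_words_Min: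
  assumes "m \<le> k"
  shows "(\<Sum>w\<in>words (Suc n) (Suc k). if Min (set w) = m then head_wt (Suc k) w else 0)
    = span_sum n (k - m)"
proof -
  have "(\<Sum>w\<in>words (Suc n) (Suc k). if Min (set w) = m then head_wt (Suc k) w else 0)
    = (\<Sum>w\<in>words (Suc n) (Suc k). \<Sum>M=m..k.
        if Min (set w) = m \<and> Max (set w) = M then head_wt (Suc k) w else 0)"
  proof (intro sum.cong refl)
    fix w assume "w \<in> words (Suc n) (Suc k)"
    note w = in_words_Suc_D[OF this]
    have "(\<Sum>M=m..k. if Min (set w) = m \<and> Max (set w) = M then head_wt (Suc k) w else 0)
      = (\<Sum>M=m..k. if M = Max (set w) then if Min (set w) = m then head_wt (Suc k) w else 0 else 0)"
      by (intro sum.cong) auto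
    then show "(if Min (set w) = m then head_wt (Suc k) w else 0)
      = (\<Sum>M=m..k. if Min (set w) = m \<and> Max (set w) = M then head_wt (Suc k) w else 0)"
      using w(2,3) by auto
  qed
  also have "\<dots> = (\<Sum>M=m..k. span_wt z q n (M - m))"
    by (subst sum.swap) (intro sum.cong refl sum_words_span, auto)
  also have "\<dots> = (\<Sum>j\<le>k - m. span_wt z q n j)"
    using assms by (intro sum.reindex_bij_witness[of _ "\<lambda>j. j + m" "\<lambda>b. b - m"]) auto
  finally show ?thesis by (simp add: span_sum_def)
qed

lemma sum_words_head_wt:
  "(\<Sum>w\<in>words (Suc n) (Suc k). head_wt (Suc k) w) = (\<Sum>l\<le>k. span_sum n l)"
proof -
  have "(\<Sum>w\<in>words (Suc n) (Suc k). head_wt (Suc k) w)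
    = (\<Sum>w\<in>words (Suc n) (Suc k). \<Sum>m\<le>k. if Min (set w) = m then head_wt (Suc k) w else 0)"
  proof (intro sum.cong refl)
    fix w assume "w \<in> words (Suc n) (Suc k)"
    note w = in_words_Suc_D[OF this]
    show "head_wt (Suc k) w = (\<Sum>m\<le>k. if Min (set w) = m then head_wt (Suc k) w else 0)"
      using w(2,3) by (simp add: sum.delta')
  qed
  also have "\<dots> = (\<Sum>m\<le>k. span_sum n (k - m))"
    by (subst sum.swap) (intro sum.cong refl sum_words_Min, auto)
  also have "\<dots> = (\<Sum>l\<le>k. span_sum n l)"
    by (intro sum.reindex_bij_witness[of _ "\<lambda>j. k - j" "\<lambda>b. k - b"]) auto
  finally show ?thesis .
qed

text \<open>Nonempty words only: an empty first part has no minimum and is treated separately in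
  \<open>word_fps_Suc\<close>. The index shift matches that of \<open>span_wt\<close>.\<close>

definition head_fps :: "nat \<Rightarrow> 'a fps" where
  "head_fps l = Abs_fps (\<lambda>n. case n of 0 \<Rightarrow> 0 | Suc n \<Rightarrow> span_sum n l)"

lemma head_fps_0: "(1 - fps_const z * fps_X) * head_fps 0 = fps_const (q * z) * fps_X"
proof (rule fps_ext)
  fix n
  have "(1 - fps_const z * fps_X) * head_fps 0 = head_fps 0 - fps_const z * (fps_X * head_fps 0)"
    by (simp add: algebra_simps)
  then show "fps_nth ((1 - fps_const z * fps_X) * head_fps 0) n = fps_nth (fps_const (q * z) * fps_X) n"
    by (cases n; cases "n - 1") (simp_all add: head_fps_def span_sum_def)
qed

text \<open>\<open>span_wt z q n (Suc l)\<close> is the difference of two consecutive values of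
  \<open>span_sum\<close>, and the sum in its recurrence is again a \<open>span_sum\<close>; so that
  recurrence becomes one of first order in \<open>l\<close>.\<close>

lemma head_fps_Suc:
  "(1 - fps_const (of_nat (Suc l) + z) * fps_X) * head_fps (Suc l)
    = (1 - fps_const (of_nat (Suc l) - q) * fps_X) * head_fps l"
proof (rule fps_ext)
  fix n
  have *: "(1 - fps_const c * fps_X) * f = f - fps_const c * (fps_X * f)" for c and f :: "'a fps"
    by (simp add: algebra_simps)
  have **: "(\<Sum>j<Suc l. g j) = (\<Sum>j\<le>l. g j)" for g :: "nat \<Rightarrow> 'a"
    by (simp add: lessThan_Suc_atMost)
  show "fps_nth ((1 - fps_const (of_nat (Suc l) + z) * fps_X) * head_fps (Suc l)) n
    = fps_nth ((1 - fps_const (of_nat (Suc l) - q) * fps_X) * head_fps l) n"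
  proof (cases n)
    case 0
    then show ?thesis by (simp add: * head_fps_def)
  next
    case (Suc n')
    then show ?thesis
      unfolding * by (cases n') (simp_all add: head_fps_def span_sum_def ** algebra_simps del: sum.lessThan_Suc of_nat_Suc)
  qed
qed

lemma head_fps_closed:
  "head_fps l * (\<Prod>j\<le>l. 1 - fps_const (of_nat j + z) * fps_X)
    = fps_const (q * z) * fps_X * shift_prod q l"
proof (induction l)
  case 0
  then show ?case using head_fps_0 by (simp add: mult.commute)
next
  case (Suc l)
  have "head_fps (Suc l) * (\<Prod>j\<le>Suc l. 1 - fps_const (of_nat j + z) * fps_X)
    = ((1 - fps_const (of_nat (Suc l) + z) * fps_X) * head_fps (Suc l))
      * (\<Prod>j\<le>l. 1 - fps_const (of_nat j + z) * fps_X)"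
    by (simp add: mult_ac)
  also have "\<dots> = (1 - fps_const (of_nat (Suc l) - q) * fps_X)
      * (head_fps l * (\<Prod>j\<le>l. 1 - fps_const (of_nat j + z) * fps_X))"
    unfolding head_fps_Suc by (simp only: mult_ac)
  also have "1 - fps_const (of_nat (Suc l) - q) * fps_X
      = 1 + (fps_const q - of_nat (Suc l)) * fps_X"
    by (simp add: algebra_simps flip: fps_of_nat fps_const_sub)
  finally show ?case
    unfolding Suc shift_prod_Suc by (simp only: mult_ac)
qed

end

section \<open>Symmetry of the word series\<close>

lemma append_Cons_last_eq_iff:
  assumes "k \<notin> set y" "k \<notin> set y'"
  shows "x @ k # y = x' @ k # y' \<longleftrightarrow> x = x' \<and> y = y'"
proof
  assume "x @ k # y = x' @ k # y'"
  then obtain us where "x = x' @ us \<and> us @ k # y = k # y' \<or> x @ us = x' \<and> k # y = us @ k # y'"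
    by (auto simp: append_eq_append_conv2)
  with assms show "x = x' \<and> y = y'"
    by (cases us) auto
qed simp

text \<open>The cut is at the last \<open>k\<close>: letters after it are below \<open>k\<close>,
  letters before it may still equal \<open>k\<close>.\<close>

lemma sum_words_split_top:
  "(\<Sum>w\<in>{w \<in> words (Suc n) (Suc k). k \<in> set w}. f w)
    = (\<Sum>i\<le>n. \<Sum>x\<in>words i (Suc k). \<Sum>y\<in>words (n - i) k. f (x @ k # y))"
proof -
  let ?S = "SIGMA i:{..n}. words i (Suc k) \<times> words (n - i) k"
  let ?h = "\<lambda>(i, x, y). x @ k # y"
  have "bij_betw ?h ?S {w \<in> words (Suc n) (Suc k). k \<in> set w}"
    unfolding bij_betw_def
  proof
    show "inj_on ?h ?S"
    proof (rule inj_onI, clarsimp)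
      fix i x y i' x' y'
      assume xy: "x @ k # y = x' @ k # y'" and x: "x \<in> words i (Suc k)" "x' \<in> words i' (Suc k)"
        and y: "y \<in> words (n - i) k" "y' \<in> words (n - i') k"
      have "k \<notin> set y" "k \<notin> set y'"
        using y by (auto simp: words_def)
      with xy have "x = x'" "y = y'"
        by (simp_all add: append_Cons_last_eq_iff)
      with x show "i = i' \<and> x = x' \<and> y = y'" by (auto simp: words_def)
    qed
    show "?h ` ?S = {w \<in> words (Suc n) (Suc k). k \<in> set w}"
    proof (intro equalityI subsetI)
      fix w assume "w \<in> ?h ` ?S"
      then show "w \<in> {w \<in> words (Suc n) (Suc k). k \<in> set w}"
        by (fastforce simp: words_def)
    next
      fix w assume w: "w \<in> {w \<in> words (Suc n) (Suc k). k \<in> set w}"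
      then obtain x y where xy: "w = x @ k # y" "k \<notin> set y"
        using split_list_last[of k w] by auto
      have "(length x, x, y) \<in> ?S"
        using w xy by (auto simp: words_def subset_iff less_Suc_eq)
      from image_eqI[OF _ this, of w ?h] show "w \<in> ?h ` ?S"
        using xy(1) by simp
    qed
  qed
  then have "(\<Sum>w\<in>{w \<in> words (Suc n) (Suc k). k \<in> set w}. f w) = (\<Sum>p\<in>?S. f (?h p))"
    by (rule sum.reindex_bij_betw[symmetric])
  then show ?thesis
    by (simp add: sum.Sigma sum.cartesian_product case_prod_unfold)
qed

text \<open>The letters of \<open>u\<close> are at most \<open>k\<close>, so the \<open>k\<close>
  behind them hides them all.\<close>

lemma rl_max_append:
  assumes "\<forall>a\<in>set u. a \<le> k" "\<forall>a\<in>set v. a < k"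
  shows "rl_max (u @ k # v) = Suc (rl_max v)"
  using assms by (induction u) auto

lemma lr_max_bounded: "\<forall>a\<in>set v. a < k \<Longrightarrow> lr_max k v = 0"
  by (induction v) auto

context
  fixes z q r :: "'a::field"
begin

definition word_wt :: "nat \<Rightarrow> nat list \<Rightarrow> 'a" where
  "word_wt k w = z ^ lr_max 0 w * q ^ lr_min k w * r ^ rl_max w"

definition word_fps :: "nat \<Rightarrow> 'a fps" where
  "word_fps k = Abs_fps (\<lambda>n. \<Sum>w\<in>words n k. word_wt k w)"

text \<open>The separating \<open>k\<close> is a weak left-to-right maximum and a right-to-left
  maximum, giving \<open>r * z\<close>; it is a new minimum only as the first letter, hence the
  extra \<open>q\<close> for \<open>i = 0\<close>. The part after it has no left-to-right maxima and
  sees the first part only through the current minimum.\<close>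

lemma word_wt_split:
  assumes "x \<in> words i (Suc k)" "y \<in> words j k"
  shows "word_wt (Suc k) (x @ k # y) = r * z * (head_wt z q (Suc k) x * (if i = 0 then q else 1)
    * (q ^ lr_min (if i = 0 then k else Min (set x)) y * r ^ rl_max y))"
proof -
  have xy: "\<forall>a\<in>set x. a \<le> k" "\<forall>a\<in>set y. a < k"
    using assms by (auto simp: words_def)
  have *: "fold max x 0 \<le> k" "fold min x (Suc k) = (if i = 0 then Suc k else Min (set x))"
    "i \<noteq> 0 \<Longrightarrow> Min (set x) \<le> k"
  proof -
    show "fold max x 0 \<le> k"
      using xy(1) by (cases "x = []") (simp_all add: fold_max_eq_Max)
    show "fold min x (Suc k) = (if i = 0 then Suc k else Min (set x))"
    proof (cases "x = []")
      case False
      then have "fold min x (Suc k) = Min (set x)"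
        using xy(1) by (intro fold_min_eq_Min) auto
      with False assms(1) show ?thesis by (auto simp: words_def)
    qed (use assms(1) in \<open>simp add: words_def\<close>)
    show "Min (set x) \<le> k" if i: "i \<noteq> 0"
    proof -
      obtain i' where "i = Suc i'" using i by (cases i) auto
      with assms(1) in_words_Suc_D(2,3)[of x i' "Suc k"] show ?thesis by simp
    qed
  qed
  show ?thesis
    using *(1,3) xy
    by (cases "i = 0") (simp_all add: word_wt_def head_wt_def lr_min_append lr_max_append *(2)
        rl_max_append lr_max_bounded leD power_add mult_ac)
qed

text \<open>Words without \<open>k\<close> give \<open>word_fps k\<close>. Among the others, the
  term with \<open>fps_const q\<close> comes from an empty first part, and a nonempty first part is
  classified by its minimum \<open>m\<close>.\<close>

lemma word_fps_Suc:
  "word_fps (Suc k) = word_fps k + fps_X * fps_const (r * z) *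
    (fps_const q * tail_fps q r k k + (\<Sum>m\<le>k. head_fps z q (k - m) * tail_fps q r k m))"
proof (rule fps_ext)
  fix n
  let ?R = "fps_const q * tail_fps q r k k + (\<Sum>m\<le>k. head_fps z q (k - m) * tail_fps q r k m)"
  have low: "(\<Sum>w\<in>words n k. word_wt (Suc k) w) = (\<Sum>w\<in>words n k. word_wt k w)"
    by (auto simp: word_wt_def words_def lr_min_bound[of _ k "Suc k"] intro!: sum.cong)
  have top: "(\<Sum>w\<in>{w \<in> words n (Suc k). k \<in> set w}. word_wt (Suc k) w)
    = fps_nth (fps_X * fps_const (r * z) * ?R) n"
  proof (cases n)
    case 0
    then have "{w \<in> words n (Suc k). k \<in> set w} = {}" by auto
    with 0 show ?thesis by (simp only: sum.empty fps_X_mult_nth mult.assoc) simp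
  next
    case (Suc n')
    let ?g = "\<lambda>m y. q ^ lr_min m y * r ^ rl_max y"
    have summand: "(\<Sum>x\<in>words i (Suc k). \<Sum>y\<in>words (n' - i) k. word_wt (Suc k) (x @ k # y))
      = r * z * ((if i = 0 then q * fps_nth (tail_fps q r k k) n' else 0)
          + (\<Sum>m\<le>k. fps_nth (head_fps z q (k - m)) i * fps_nth (tail_fps q r k m) (n' - i)))" for i
    proof -
      have "(\<Sum>x\<in>words i (Suc k). \<Sum>y\<in>words (n' - i) k. word_wt (Suc k) (x @ k # y))
        = r * z * (\<Sum>x\<in>words i (Suc k). head_wt z q (Suc k) x * (if i = 0 then q else 1) *
            (\<Sum>y\<in>words (n' - i) k. ?g (if i = 0 then k else Min (set x)) y))"
        unfolding sum_distrib_left by (intro sum.cong refl word_wt_split)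
      also have "(\<Sum>x\<in>words i (Suc k). head_wt z q (Suc k) x * (if i = 0 then q else 1) *
            (\<Sum>y\<in>words (n' - i) k. ?g (if i = 0 then k else Min (set x)) y))
        = (if i = 0 then q * fps_nth (tail_fps q r k k) n' else 0)
          + (\<Sum>m\<le>k. fps_nth (head_fps z q (k - m)) i * fps_nth (tail_fps q r k m) (n' - i))"
      proof (cases i)
        case 0
        then show ?thesis by (simp add: head_wt_def head_fps_def tail_fps_def)
      next
        case (Suc i')
        have "(\<Sum>x\<in>words (Suc i') (Suc k). head_wt z q (Suc k) x *
            (\<Sum>y\<in>words (n' - i) k. ?g (Min (set x)) y))
          = (\<Sum>x\<in>words (Suc i') (Suc k). \<Sum>m\<le>k. (if Min (set x) = m then head_wt z q (Suc k) x else 0)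
            * (\<Sum>y\<in>words (n' - i) k. ?g m y))"
        proof (intro sum.cong refl)
          fix x assume "x \<in> words (Suc i') (Suc k)"
          then have "Min (set x) \<le> k" using in_words_Suc_D(2,3)[of x i' "Suc k"] by linarith
          have "(\<Sum>m\<le>k. (if Min (set x) = m then head_wt z q (Suc k) x else 0)
            * (\<Sum>y\<in>words (n' - i) k. ?g m y))
            = (\<Sum>m\<le>k. if m = Min (set x) then head_wt z q (Suc k) x
            * (\<Sum>y\<in>words (n' - i) k. ?g m y) else 0)"
            by (intro sum.cong) auto
          with \<open>Min (set x) \<le> k\<close> show "head_wt z q (Suc k) x * (\<Sum>y\<in>words (n' - i) k. ?g (Min (set x)) y)
            = (\<Sum>m\<le>k. (if Min (set x) = m then head_wt z q (Suc k) x else 0)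
              * (\<Sum>y\<in>words (n' - i) k. ?g m y))"
            by simp
        qed
        also have "\<dots> = (\<Sum>m\<le>k. span_sum z q i' (k - m) * (\<Sum>y\<in>words (n' - i) k. ?g m y))"
          by (subst sum.swap) (intro sum.cong refl, simp only: sum_words_Min atMost_iff flip: sum_distrib_right)
        finally show ?thesis using Suc by (simp add: head_fps_def tail_fps_def)
      qed
      finally show ?thesis .
    qed
    have "(\<Sum>w\<in>{w \<in> words n (Suc k). k \<in> set w}. word_wt (Suc k) w)
      = r * z * (\<Sum>i\<le>n'. (if i = 0 then q * fps_nth (tail_fps q r k k) n' else 0)
          + (\<Sum>m\<le>k. fps_nth (head_fps z q (k - m)) i * fps_nth (tail_fps q r k m) (n' - i)))"
      unfolding Suc sum_words_split_top summand by (simp only: sum_distrib_left)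
    also have "\<dots> = r * z * (q * fps_nth (tail_fps q r k k) n'
          + (\<Sum>m\<le>k. \<Sum>i=0..n'. fps_nth (head_fps z q (k - m)) i * fps_nth (tail_fps q r k m) (n' - i)))"
      by (subst sum.swap) (simp add: sum.distrib atLeast0AtMost)
    also have "\<dots> = fps_nth (fps_X * fps_const (r * z) * ?R) n"
    proof -
      have "fps_nth (fps_X * fps_const (r * z) * ?R) n = r * z * fps_nth ?R n'"
        by (simp only: Suc mult.assoc fps_X_mult_nth fps_mult_left_const_nth) simp
      then show ?thesis by (simp add: fps_sum_nth fps_mult_nth[of "head_fps _ _ _"])
    qed
    finally show ?thesis .
  qed
  show "fps_nth (word_fps (Suc k)) n = fps_nth (word_fps k + fps_X * fps_const (r * z) * ?R) n"
    by (simp add: word_fps_def sum_words_Suc_letter low top)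
qed

end

text \<open>The denominator \<open>D\<close> is free of \<open>q\<close> and \<open>r\<close>.
  Clearing it leaves \<open>r * q * z\<close>, \<open>fps_X\<close> and \<open>sym_tail\<close>, all
  symmetric.\<close>

lemma head_tail_commute:
  fixes z q r :: "'a::field"
  assumes "m \<le> k"
  shows "fps_const r * (head_fps z q (k - m) * tail_fps q r k m)
    = fps_const q * (head_fps z r (k - m) * tail_fps r q k m)"
proof -
  define D where "D = (\<Prod>j\<le>k - m. 1 - fps_const (of_nat j + z) * fps_X)"
  have "1 - c * fps_X \<noteq> 0" for c :: "'a fps"
    using one_minus_fps_X_cancel[of c 1 0] by auto
  then have "D \<noteq> 0"
    by (simp add: D_def)
  have 1: "fps_const r * (head_fps z q (k - m) * tail_fps q r k m) * D
    = fps_const (r * q * z) * fps_X * sym_tail q r k m" for q r :: 'a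
  proof -
    have "fps_const r * (head_fps z q (k - m) * tail_fps q r k m) * D
      = fps_const r * (head_fps z q (k - m) * D) * tail_fps q r k m"
      by (simp only: mult_ac)
    also have "\<dots> = fps_const r * fps_const (q * z) * fps_X * sym_tail q r k m"
      unfolding D_def head_fps_closed sym_tail_def by (simp only: mult_ac)
    finally show ?thesis by (simp add: mult_ac)
  qed
  have "fps_const r * (head_fps z q (k - m) * tail_fps q r k m) * D
    = fps_const q * (head_fps z r (k - m) * tail_fps r q k m) * D"
    unfolding 1 sym_tail_commute[OF assms, of q r] by (simp add: mult_ac)
  with \<open>D \<noteq> 0\<close> show ?thesis by simp
qed

lemma word_fps_commute: "word_fps z q r k = word_fps z r q k"
proof (induction k)
  case 0
  have "words n 0 = (if n = 0 then {[]} else {})" for n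
    by (auto simp: words_def)
  then show ?case
    by (auto simp: fps_eq_iff word_fps_def word_wt_def)
next
  case (Suc k)
  have tail: "tail_fps q r k k = tail_fps r q k k"
    using sym_tail_commute[of k k q r] by (simp add: sym_tail_def)
  have *: "word_fps z q r (Suc k) = word_fps z q r k + fps_X * fps_const z *
    (fps_const (r * q) * tail_fps q r k k
      + (\<Sum>m\<le>k. fps_const r * (head_fps z q (k - m) * tail_fps q r k m)))" for q r
    by (simp add: word_fps_Suc algebra_simps sum_distrib_left flip: fps_const_mult)
  have sum: "(\<Sum>m\<le>k. fps_const r * (head_fps z q (k - m) * tail_fps q r k m))
    = (\<Sum>m\<le>k. fps_const q * (head_fps z r (k - m) * tail_fps r q k m))"
    by (intro sum.cong refl head_tail_commute) simp
  show ?case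
    unfolding * Suc tail sum by (simp only: mult.commute[of q r])
qed

section \<open>Standardization\<close>

lemma words_iff_nth: "w \<in> words n k \<longleftrightarrow> length w = n \<and> (\<forall>i<n. w ! i < k)"
  by (auto simp: words_def subset_iff in_set_conv_nth)

text \<open>P-partitions of a chain: \<open>b ! i\<close> will be the letter placed on the value
  \<open>Suc i\<close>, and \<open>D\<close> will mark the inverse descents.\<close>

definition chains :: "(nat \<Rightarrow> bool) \<Rightarrow> nat \<Rightarrow> nat \<Rightarrow> nat list set" where
  "chains D n k = {b \<in> words n k.
     \<forall>i. Suc i < n \<longrightarrow> (if D i then b ! i < b ! Suc i else b ! i \<le> b ! Suc i)}"

lemma chains_sorted: "b \<in> chains D n k \<Longrightarrow> sorted b"
  by (auto simp: chains_def words_def sorted_iff_nth_Suc intro: less_imp_le split: if_splits)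

lemma finite_chains [simp]: "finite (chains D n k)"
  by (simp add: chains_def)

text \<open>A chain is sorted, so its last letter \<open>x\<close> bounds all others, strictly if
  \<open>D n\<close> holds; they form a chain over the letters below \<open>x\<close> or below
  \<open>Suc x\<close>.\<close>

lemma card_chains_snoc:
  "card (chains D (Suc (Suc n)) k) = (\<Sum>x<k. card (chains D (Suc n) (if D n then x else Suc x)))"
proof -
  let ?S = "SIGMA x:{..<k}. chains D (Suc n) (if D n then x else Suc x)"
  have "chains D (Suc (Suc n)) k = (\<lambda>(x, b). b @ [x]) ` ?S"
  proof (intro equalityI subsetI)
    fix c assume c: "c \<in> chains D (Suc (Suc n)) k"
    then have len: "length c = Suc (Suc n)" by (simp add: chains_def words_def)
    define b x where "b = butlast c" and "x = last c"
    have cb: "c = b @ [x]" "length b = Suc n"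
      using len by (auto simp: b_def x_def intro: append_butlast_last_id[symmetric])
    have "sorted b" using chains_sorted[OF c] cb by (simp add: sorted_append)
    have bi: "if D i then b ! i < b ! Suc i else b ! i \<le> b ! Suc i" if "Suc i < Suc n" for i
    proof -
      have "if D i then c ! i < c ! Suc i else c ! i \<le> c ! Suc i"
        using c that by (auto simp: chains_def)
      with that show ?thesis by (simp add: cb nth_append split: if_splits)
    qed
    have last: "if D n then b ! n < x else b ! n \<le> x"
    proof -
      have "if D n then c ! n < c ! Suc n else c ! n \<le> c ! Suc n"
        using c by (auto simp: chains_def)
      then show ?thesis by (simp add: cb nth_append split: if_splits)
    qed
    have "y < (if D n then x else Suc x)" if y: "y \<in> set b" for y
    proof -
      obtain i where "i \<le> n" "y = b ! i"
        using y cb(2) by (auto simp: in_set_conv_nth less_Suc_eq_le)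
      then have "y \<le> b ! n"
        using sorted_nth_mono[OF \<open>sorted b\<close>, of i n] cb(2) by simp
      with last show ?thesis by (auto split: if_splits)
    qed
    moreover have "x < k" using c cb by (auto simp: chains_def words_def)
    ultimately have "(x, b) \<in> ?S"
      using bi cb(2) by (auto simp: chains_def words_def)
    then show "c \<in> (\<lambda>(x, b). b @ [x]) ` ?S"
      using cb(1) by force
  next
    fix c assume "c \<in> (\<lambda>(x, b). b @ [x]) ` ?S"
    then obtain x b where xb: "c = b @ [x]" "x < k" "b \<in> chains D (Suc n) (if D n then x else Suc x)"
      by auto
    then have len: "length b = Suc n" and b: "set b \<subseteq> {..<if D n then x else Suc x}"
      by (auto simp: chains_def words_def)
    have "b ! n \<in> set b" using len by simp
    with b have last: "b ! n < (if D n then x else Suc x)" by blast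
    have "set c \<subseteq> {..<k}" using b xb by (force split: if_splits)
    moreover have "if D i then c ! i < c ! Suc i else c ! i \<le> c ! Suc i" if "Suc i < Suc (Suc n)" for i
    proof (cases "i = n")
      case True
      with last len xb(1) show ?thesis by (simp add: nth_append split: if_splits)
    next
      case False
      then have "if D i then b ! i < b ! Suc i else b ! i \<le> b ! Suc i"
        using xb(3) that by (auto simp: chains_def)
      with False that len xb(1) show ?thesis by (simp add: nth_append)
    qed
    ultimately show "c \<in> chains D (Suc (Suc n)) k"
      using len xb(1) by (auto simp: chains_def words_def)
  qed
  moreover have "inj_on (\<lambda>(x, b). b @ [x]) ?S" by (auto simp: inj_on_def)
  ultimately show ?thesis by (simp add: card_image)
qed

text \<open>The variable marks the alphabet size. A single letter gives
  \<open>fps_X / (1 - fps_X) ^ 2\<close>; each further letter takes partial sums, which divides by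
  \<open>1 - fps_X\<close>, and a strict step adds a factor \<open>fps_X\<close>.\<close>

lemma chains_fps:
  "Abs_fps (\<lambda>k. of_nat (card (chains D (Suc n) k))) * (1 - fps_X) ^ (n + 2)
    = (fps_X ^ Suc (card {i. i < n \<and> D i}) :: 'a::comm_ring_1 fps)"
proof (induction n)
  case 0
  have "chains D (Suc 0) k = (\<lambda>x. [x]) ` {..<k}" for k
    by (auto simp: chains_def words_def length_Suc_conv)
  then have "card (chains D (Suc 0) k) = k" for k
    by (simp add: card_image inj_on_def)
  moreover have "Abs_fps of_nat * (1 - fps_X) ^ 2 = (fps_X :: 'a fps)"
  proof -
    have "Abs_fps of_nat * (1 - fps_X) = fps_X * Abs_fps (\<lambda>_. 1 :: 'a)"
      by (rule fps_ext, case_tac n) (simp_all add: algebra_simps)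
    moreover have "Abs_fps (\<lambda>_. 1 :: 'a) * (1 - fps_X) = 1"
      by (rule fps_ext, case_tac n) (simp_all add: algebra_simps)
    ultimately show ?thesis by (simp add: power2_eq_square mult.assoc flip: mult.assoc[of "Abs_fps of_nat"])
  qed
  ultimately show ?case by (simp add: power2_eq_square)
next
  case (Suc n)
  let ?G = "\<lambda>n. Abs_fps (\<lambda>k. of_nat (card (chains D n k)) :: 'a)"
  \<comment> \<open>With no chains at size 0, the shifted sum over \<open>Suc x\<close> in a weak
    step is still a full partial sum.\<close>
  have empty: "chains D (Suc m) 0 = {}" for m
    by (auto simp: chains_def words_def)
  have "?G (Suc (Suc n)) * (1 - fps_X) = (if D n then fps_X else 1) * ?G (Suc n)"
  proof (rule fps_ext)
    fix k
    show "fps_nth (?G (Suc (Suc n)) * (1 - fps_X)) k = fps_nth ((if D n then fps_X else 1) * ?G (Suc n)) k"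
      by (cases k) (simp_all add: algebra_simps empty card_chains_snoc)
  qed
  then have "?G (Suc (Suc n)) * (1 - fps_X) ^ (Suc n + 2)
      = (if D n then fps_X else 1) * (?G (Suc n) * (1 - fps_X) ^ (n + 2))"
    by (simp add: mult.assoc[symmetric])
  also have "\<dots> = (if D n then fps_X else 1) * fps_X ^ Suc (card {i. i < n \<and> D i})"
    by (simp only: Suc)
  also have "\<dots> = fps_X ^ Suc (card {i. i < Suc n \<and> D i})"
  proof -
    have "{i. i < Suc n \<and> D i} = (if D n then insert n {i. i < n \<and> D i} else {i. i < n \<and> D i})"
      by (auto simp: less_Suc_eq)
    then show ?thesis by simp
  qed
  finally show ?case .
qed

text \<open>The permutation ranks the letters of the word, equal letters from left to right.\<close>

definition standardizes :: "nat \<Rightarrow> nat list \<Rightarrow> (nat \<Rightarrow> nat) \<Rightarrow> bool" where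
  "standardizes n w \<pi> \<longleftrightarrow>
     (\<forall>i\<in>{1..n}. \<forall>j\<in>{1..n}. i < j \<longrightarrow> (w ! (i - 1) \<le> w ! (j - 1) \<longleftrightarrow> \<pi> i < \<pi> j))"

lemma perms_inv:
  assumes "\<pi> \<in> perms n"
  shows "\<pi> (inv \<pi> i) = i" "inv \<pi> (\<pi> i) = i"
    "i \<in> {1..n} \<Longrightarrow> \<pi> i \<in> {1..n}" "i \<in> {1..n} \<Longrightarrow> inv \<pi> i \<in> {1..n}"
    "inj \<pi>"
  using assms permutes_in_image[of \<pi> "{1..n}"] permutes_in_image[OF permutes_inv, of \<pi> "{1..n}"]
  by (auto simp: perms_def permutes_inverses permutes_inj permutes_inv)

lemma finite_perms [simp]: "finite (perms n)"
  by (simp add: perms_def finite_permutations)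

lemma perms_eq_card:
  assumes "\<pi> \<in> perms n" "i \<in> {1..n}"
  shows "\<pi> i = card {j \<in> {1..n}. \<pi> j \<le> \<pi> i}"
proof -
  have "\<pi> ` {j \<in> {1..n}. \<pi> j \<le> \<pi> i} = {1..\<pi> i}"
  proof (intro equalityI subsetI)
    fix a assume "a \<in> {1..\<pi> i}"
    moreover from this have "inv \<pi> a \<in> {1..n}"
      using perms_inv(3,4)[OF assms(1)] assms(2) by (meson atLeastAtMost_iff le_trans)
    ultimately show "a \<in> \<pi> ` {j \<in> {1..n}. \<pi> j \<le> \<pi> i}"
      using perms_inv(1)[OF assms(1)] by (intro image_eqI[of _ _ "inv \<pi> a"]) auto
  qed (use perms_inv(3)[OF assms(1)] in auto)
  moreover have "card (\<pi> ` {j \<in> {1..n}. \<pi> j \<le> \<pi> i}) = card {j \<in> {1..n}. \<pi> j \<le> \<pi> i}"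
    by (rule card_image) (rule inj_on_subset[OF perms_inv(5)[OF assms(1)] subset_UNIV])
  ultimately show ?thesis by simp
qed

lemma standardizes_le_iff:
  assumes "\<pi> \<in> perms n" "standardizes n w \<pi>" "i \<in> {1..n}" "j \<in> {1..n}"
  shows "\<pi> j \<le> \<pi> i \<longleftrightarrow> w ! (j - 1) < w ! (i - 1) \<or> w ! (j - 1) = w ! (i - 1) \<and> j \<le> i"
proof (cases i j rule: linorder_cases)
  case less
  then have "w ! (i - 1) \<le> w ! (j - 1) \<longleftrightarrow> \<pi> i < \<pi> j"
    using assms by (auto simp: standardizes_def)
  with less show ?thesis by auto
next
  case greater
  then have "w ! (j - 1) \<le> w ! (i - 1) \<longleftrightarrow> \<pi> j < \<pi> i"
    using assms by (auto simp: standardizes_def)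
  moreover have "\<pi> i \<noteq> \<pi> j"
    using greater perms_inv(5)[OF assms(1)] by (auto dest: injD)
  ultimately show ?thesis using greater by auto
qed simp

text \<open>The word fixes the relative order of the values (\<open>standardizes_le_iff\<close>),
  and a value is its rank (\<open>perms_eq_card\<close>).\<close>

lemma standardizes_unique:
  assumes "\<pi> \<in> perms n" "standardizes n w \<pi>" "\<rho> \<in> perms n" "standardizes n w \<rho>"
  shows "\<pi> = \<rho>"
proof
  fix i
  show "\<pi> i = \<rho> i"
  proof (cases "i \<in> {1..n}")
    case True
    then have "{j \<in> {1..n}. \<pi> j \<le> \<pi> i} = {j \<in> {1..n}. \<rho> j \<le> \<rho> i}"
      using standardizes_le_iff[OF assms(1,2)] standardizes_le_iff[OF assms(3,4)] by auto
    then show ?thesis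
      using perms_eq_card[OF assms(1) True] perms_eq_card[OF assms(3) True] by simp
  next
    case False
    then show ?thesis
      using assms(1,3) by (simp add: perms_def permutes_not_in)
  qed
qed

lemma standardizes_exists: "\<exists>\<pi>. \<pi> \<in> perms n \<and> standardizes n w \<pi>"
proof -
  \<comment> \<open>\<open>R i\<close> collects the positions up to \<open>i\<close> in the order by
    letter, then by position; its size is the rank of \<open>i\<close>.\<close>
  define R where "R i = {j \<in> {1..n}. w ! (j - 1) < w ! (i - 1) \<or> w ! (j - 1) = w ! (i - 1) \<and> j \<le> i}" for i
  define \<pi> where "\<pi> i = (if i \<in> {1..n} then card (R i) else i)" for i
  have [simp]: "finite (R i)" for i by (simp add: R_def)
  have up: "\<pi> i < \<pi> j" if "i \<in> {1..n}" "j \<in> {1..n}" "i < j" "w ! (i - 1) \<le> w ! (j - 1)" for i j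
  proof -
    have "R i \<subseteq> R j" "j \<in> R j" "j \<notin> R i" using that by (auto simp: R_def)
    then have "card (R i) < card (R j)" by (intro psubset_card_mono) auto
    with that show ?thesis by (simp add: \<pi>_def)
  qed
  have down: "\<pi> j < \<pi> i" if "i \<in> {1..n}" "j \<in> {1..n}" "i < j" "w ! (j - 1) < w ! (i - 1)" for i j
  proof -
    have "R j \<subseteq> R i" "i \<in> R i" "i \<notin> R j" using that by (auto simp: R_def)
    then have "card (R j) < card (R i)" by (intro psubset_card_mono) auto
    with that show ?thesis by (simp add: \<pi>_def)
  qed
  have iff: "w ! (i - 1) \<le> w ! (j - 1) \<longleftrightarrow> \<pi> i < \<pi> j" if "i \<in> {1..n}" "j \<in> {1..n}" "i < j" for i j
    using up[OF that] down[OF that] by (meson linorder_not_less order_less_asym)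
  have "\<pi> permutes {1..n}"
  proof (rule inj_imp_permutes)
    show "inj_on \<pi> {1..n}"
    proof (rule linorder_inj_onI')
      fix i j assume "i \<in> {1..n}" "j \<in> {1..n}" "i < j"
      then show "\<pi> i \<noteq> \<pi> j"
        using up[of i j] down[of i j] by (cases "w ! (i - 1) \<le> w ! (j - 1)") auto
    qed
  next
    fix i assume i: "i \<in> {1..n}"
    then have "i \<in> R i" by (simp add: R_def)
    then have "0 < card (R i)" by (auto simp: card_gt_0_iff)
    moreover have "card (R i) \<le> card {1..n}" by (rule card_mono) (auto simp: R_def)
    moreover have "\<pi> i = card (R i)" using i by (simp add: \<pi>_def)
    ultimately show "\<pi> i \<in> {1..n}" by (simp only: atLeastAtMost_iff card_atLeastAtMost) linarith
  qed (auto simp: \<pi>_def)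
  then show ?thesis
    using iff by (intro exI[of _ \<pi>]) (simp add: perms_def standardizes_def)
qed

lemma sum_words_standardize:
  fixes g :: "nat list \<Rightarrow> 'a::comm_monoid_add"
  shows "(\<Sum>w\<in>words n k. g w) = (\<Sum>\<pi>\<in>perms n. \<Sum>w\<in>{w \<in> words n k. standardizes n w \<pi>}. g w)"
proof -
  have "(\<Sum>w\<in>words n k. g w) = (\<Sum>w\<in>words n k. \<Sum>\<pi>\<in>perms n. if standardizes n w \<pi> then g w else 0)"
  proof (intro sum.cong refl)
    fix w
    obtain \<rho> where "\<rho> \<in> perms n" "standardizes n w \<rho>"
      using standardizes_exists by blast
    then have "(\<Sum>\<pi>\<in>perms n. if standardizes n w \<pi> then g w else 0)
      = (\<Sum>\<pi>\<in>perms n. if \<pi> = \<rho> then g w else 0)"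
      using standardizes_unique by (intro sum.cong) auto
    with \<open>\<rho> \<in> perms n\<close> show "g w = (\<Sum>\<pi>\<in>perms n. if standardizes n w \<pi> then g w else 0)"
      by simp
  qed
  also have "\<dots> = (\<Sum>\<pi>\<in>perms n. \<Sum>w\<in>words n k. if standardizes n w \<pi> then g w else 0)"
    by (rule sum.swap)
  finally show ?thesis by (simp add: sum.inter_filter)
qed

lemma chain_to_word_standardizes:
  assumes "\<pi> \<in> perms n" "b \<in> chains (\<lambda>i. inv \<pi> (Suc i) > inv \<pi> (Suc (Suc i))) n k"
    and w: "\<And>i. i \<in> {1..n} \<Longrightarrow> w ! (i - 1) = b ! (\<pi> i - 1)"
  shows "standardizes n w \<pi>"
  unfolding standardizes_def
proof (intro ballI impI)
  fix i j assume ij: "i \<in> {1..n}" "j \<in> {1..n}" "i < j"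
  note p = perms_inv[OF assms(1)]
  have b: "sorted b" "length b = n"
    using chains_sorted[OF assms(2)] assms(2) by (auto simp: chains_def words_def)
  have pi: "\<pi> i \<in> {1..n}" "\<pi> j \<in> {1..n}" using ij p(3) by auto
  show "w ! (i - 1) \<le> w ! (j - 1) \<longleftrightarrow> \<pi> i < \<pi> j"
  proof (cases "\<pi> i < \<pi> j")
    case True
    then have "b ! (\<pi> i - 1) \<le> b ! (\<pi> j - 1)"
      using pi b by (intro sorted_nth_mono) auto
    with True w[OF ij(1)] w[OF ij(2)] show ?thesis by simp
  next
    case False
    have "\<pi> i \<noteq> \<pi> j" using ij(3) p(5) by (auto dest: injD)
    with False have lt: "\<pi> j < \<pi> i" by simp
    \<comment> \<open>From the value \<open>\<pi> j\<close> up to \<open>\<pi> i\<close> the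
      position drops from \<open>j\<close> to \<open>i\<close>, so some step \<open>s\<close> is an
      inverse descent, and there \<open>b\<close> increases strictly.\<close>
    have "\<exists>s. \<pi> j \<le> s \<and> s < \<pi> i \<and> inv \<pi> s > inv \<pi> (Suc s)"
    proof (rule ccontr)
      assume "\<not> ?thesis"
      then have step: "inv \<pi> s \<le> inv \<pi> (Suc s)" if "\<pi> j \<le> s" "s < \<pi> i" for s
        using that by (auto simp: not_less)
      have "inv \<pi> (\<pi> j) \<le> inv \<pi> (\<pi> j + d)" if "\<pi> j + d \<le> \<pi> i" for d
        using that
      proof (induction d)
        case (Suc d)
        with step[of "\<pi> j + d"] show ?case by simp
      qed simp
      from this[of "\<pi> i - \<pi> j"] lt have "inv \<pi> (\<pi> j) \<le> inv \<pi> (\<pi> i)" by simp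
      with ij(3) show False by (simp add: p)
    qed
    then obtain s where s: "\<pi> j \<le> s" "s < \<pi> i" "inv \<pi> s > inv \<pi> (Suc s)" by blast
    then obtain t where t: "s = Suc t" using pi by (cases s) auto
    have "b ! (\<pi> j - 1) \<le> b ! t" using s t pi b by (intro sorted_nth_mono) auto
    also have "b ! t < b ! Suc t" using assms(2) s t pi by (auto simp: chains_def)
    also have "b ! Suc t \<le> b ! (\<pi> i - 1)" using s t pi b by (intro sorted_nth_mono) auto
    finally have "w ! (j - 1) < w ! (i - 1)" using ij by (simp only: w)
    with False show ?thesis by simp
  qed
qed

text \<open>Consecutive values carry weakly increasing letters, and equal letters must stand in
  increasing positions; an inverse descent therefore rules out equality.\<close>

lemma word_to_chain:
  assumes "\<pi> \<in> perms n" "standardizes n w \<pi>" "Suc i < n"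
  shows "if inv \<pi> (Suc i) > inv \<pi> (Suc (Suc i))
    then w ! (inv \<pi> (Suc i) - 1) < w ! (inv \<pi> (Suc (Suc i)) - 1)
    else w ! (inv \<pi> (Suc i) - 1) \<le> w ! (inv \<pi> (Suc (Suc i)) - 1)"
proof -
  note p = perms_inv[OF assms(1)]
  have "inv \<pi> (Suc i) \<in> {1..n}" "inv \<pi> (Suc (Suc i)) \<in> {1..n}"
    using p(4)[of "Suc i"] p(4)[of "Suc (Suc i)"] assms(3) by auto
  note standardizes_le_iff[OF assms(1,2) this(2,1)]
  then show ?thesis by (auto simp: p)
qed

lemma card_words_standardize:
  assumes "\<pi> \<in> perms n"
  shows "card {w \<in> words n k. standardizes n w \<pi>}
    = card (chains (\<lambda>i. inv \<pi> (Suc i) > inv \<pi> (Suc (Suc i))) n k)" (is "card ?W = card ?C")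
proof -
  note p = perms_inv[OF assms]
  \<comment> \<open>\<open>f\<close> lists the letters in order of value, \<open>g\<close> in order
    of position; the shifts translate between list indices from 0 and positions and values from
    1.\<close>
  define f where "f w = map (\<lambda>i. w ! (inv \<pi> (Suc i) - 1)) [0..<n]" for w :: "nat list"
  define g where "g b = map (\<lambda>i. b ! (\<pi> (Suc i) - 1)) [0..<n]" for b :: "nat list"
  have p': "inv \<pi> (Suc i) - Suc 0 < n" "\<pi> (Suc i) - Suc 0 < n" if "i < n" for i
    using p(3)[of "Suc i"] p(4)[of "Suc i"] that by auto
  have p'': "Suc (inv \<pi> (Suc i) - Suc 0) = inv \<pi> (Suc i)" "Suc (\<pi> (Suc i) - Suc 0) = \<pi> (Suc i)" if "i < n" for i
    using p(3)[of "Suc i"] p(4)[of "Suc i"] that by auto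
  have "bij_betw f ?W ?C"
  proof (rule bij_betw_byWitness[where f' = g])
    show "\<forall>w\<in>?W. g (f w) = w"
    proof
      fix w assume "w \<in> ?W"
      then have "length w = n" by (simp add: words_def)
      then show "g (f w) = w"
        by (intro nth_equalityI) (simp_all add: f_def g_def p' p'' p)
    qed
    show "\<forall>b\<in>?C. f (g b) = b"
    proof
      fix b assume "b \<in> ?C"
      then have "length b = n" by (simp add: words_def chains_def)
      then show "f (g b) = b"
        by (intro nth_equalityI) (simp_all add: f_def g_def p' p'' p)
    qed
    show "f ` ?W \<subseteq> ?C"
    proof (clarify)
      fix w assume w: "w \<in> words n k" "standardizes n w \<pi>"
      have "f w \<in> words n k"
        using w(1) p' by (simp add: f_def words_iff_nth)
      moreover have "if inv \<pi> (Suc i) > inv \<pi> (Suc (Suc i)) then f w ! i < f w ! Suc i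
          else f w ! i \<le> f w ! Suc i" if "Suc i < n" for i
        using word_to_chain[OF assms w(2) that] that by (simp add: f_def split: if_splits)
      ultimately show "f w \<in> ?C" by (simp add: chains_def)
    qed
    show "g ` ?C \<subseteq> ?W"
    proof (clarify)
      fix b assume b: "b \<in> ?C"
      then have "g b \<in> words n k"
        using p' by (simp add: g_def words_iff_nth chains_def)
      moreover have "standardizes n (g b) \<pi>"
      proof (rule chain_to_word_standardizes[OF assms b])
        fix i assume "i \<in> {1..n}"
        then show "g b ! (i - 1) = b ! (\<pi> i - 1)"
          by (cases i) (auto simp: g_def)
      qed
      ultimately show "g b \<in> words n k \<and> standardizes n (g b) \<pi>" ..
    qed
  qed
  then show ?thesis by (rule bij_betw_same_card)
qed

section \<open>Records of a word and of its standardization\<close>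

lemma card_less_Suc_split:
  "card {i. i < Suc n \<and> P i} = (if P 0 then 1 else 0) + card {i. i < n \<and> P (Suc i)}"
proof -
  have "{i. i < Suc n \<and> P i} = {i::nat. i = 0 \<and> P 0} \<union> Suc ` {i. i < n \<and> P (Suc i)}"
    by (auto simp: less_Suc_eq_0_disj)
  moreover have "{i::nat. i = 0 \<and> P 0} \<inter> Suc ` {i. i < n \<and> P (Suc i)} = {}" by auto
  ultimately have "card {i. i < Suc n \<and> P i}
      = card {i::nat. i = 0 \<and> P 0} + card (Suc ` {i. i < n \<and> P (Suc i)})"
    by (simp add: card_Un_disjoint)
  moreover have "{i::nat. i = 0 \<and> P 0} = (if P 0 then {0} else {})" by auto
  ultimately show ?thesis by (simp add: card_image)
qed

text \<open>The record \<open>m\<close> has to stay arbitrary: behind a first letter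
  \<open>x\<close> the condition becomes \<open>max m x <= w ! i\<close>.\<close>

lemma lr_max_eq_card:
  "lr_max m w = card {i. i < length w \<and> m \<le> w ! i \<and> (\<forall>j<i. w ! j \<le> w ! i)}"
proof (induction w arbitrary: m)
  case (Cons x w)
  have *: "(\<forall>j<Suc i. (x # w) ! j \<le> a) \<longleftrightarrow> x \<le> a \<and> (\<forall>j<i. w ! j \<le> a)" for i a
    by (auto simp: less_Suc_eq_0_disj)
  have "{i. i < length w \<and> m \<le> w ! i \<and> x \<le> w ! i \<and> (\<forall>j<i. w ! j \<le> w ! i)}
    = {i. i < length w \<and> max m x \<le> w ! i \<and> (\<forall>j<i. w ! j \<le> w ! i)}"
    by auto
  then show ?case
    using Cons[of "max m x"] by (simp only: list.size add_0_right add_Suc_right card_less_Suc_split nth_Cons_Suc *) (auto simp: max_def)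
qed simp

lemma lr_min_eq_card:
  "lr_min m w = card {i. i < length w \<and> w ! i < m \<and> (\<forall>j<i. w ! i < w ! j)}"
proof (induction w arbitrary: m)
  case (Cons x w)
  have *: "(\<forall>j<Suc i. a < (x # w) ! j) \<longleftrightarrow> a < x \<and> (\<forall>j<i. a < w ! j)" for i a
    by (auto simp: less_Suc_eq_0_disj)
  have "{i. i < length w \<and> w ! i < m \<and> w ! i < x \<and> (\<forall>j<i. w ! i < w ! j)}
    = {i. i < length w \<and> w ! i < min m x \<and> (\<forall>j<i. w ! i < w ! j)}"
    by auto
  then show ?case
    using Cons[of "min m x"] by (simp only: list.size add_0_right add_Suc_right card_less_Suc_split nth_Cons_Suc *) (auto simp: min_def)
qed simp

lemma rl_max_eq_card:
  "rl_max w = card {i. i < length w \<and> (\<forall>j. i < j \<and> j < length w \<longrightarrow> w ! j < w ! i)}"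
proof (induction w)
  case (Cons x w)
  have *: "(\<forall>j. Suc i < j \<and> j < Suc l \<longrightarrow> (x # w) ! j < a) \<longleftrightarrow> (\<forall>j. i < j \<and> j < l \<longrightarrow> w ! j < a)" for i l a
    by (metis Suc_less_eq Suc_less_eq2 nth_Cons_Suc)
  have **: "(\<forall>j. 0 < j \<and> j < Suc (length w) \<longrightarrow> (x # w) ! j < x) \<longleftrightarrow> (\<forall>y\<in>set w. y < x)"
    by (auto simp: all_set_conv_all_nth gr0_conv_Suc)
  show ?case
    using Cons by (simp only: list.size add_0_right add_Suc_right card_less_Suc_split nth_Cons_Suc nth_Cons_0 * **) auto
qed simp

lemma card_perm_values:
  assumes "\<pi> \<in> perms n"
  shows "card {\<pi> i | i. i \<in> {1..n} \<and> P i} = card {i. i < n \<and> P (Suc i)}"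
proof -
  have "{\<pi> i | i. i \<in> {1..n} \<and> P i} = (\<lambda>i. \<pi> (Suc i)) ` {i. i < n \<and> P (Suc i)}"
    by (auto simp: image_iff Bex_def) (metis Suc_le_eq Suc_pred)
  moreover have "inj (\<lambda>i. \<pi> (Suc i))"
    using perms_inv(5)[OF assms] by (auto simp: inj_def)
  ultimately show ?thesis by (simp add: card_image inj_on_subset)
qed

text \<open>Under \<open>standardizes\<close>, values rise from an earlier to a later position iff
  the letters rise weakly, and fall iff the letters fall strictly. This is why maxima from the left
  are weak and the other two kinds of record are strict.\<close>

lemma
  assumes "\<pi> \<in> perms n" "w \<in> words n k" "standardizes n w \<pi>"
  shows lr_max_standardize: "lr_max 0 w = lmax n \<pi>"
    and lr_min_standardize: "lr_min k w = lmin n \<pi>"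
    and rl_max_standardize: "rl_max w = rmax n \<pi>"
proof -
  have len: "length w = n" and lt: "\<And>i. i < n \<Longrightarrow> w ! i < k"
    using assms(2) by (auto simp: words_iff_nth)
  have iff: "w ! i \<le> w ! j \<longleftrightarrow> \<pi> (Suc i) < \<pi> (Suc j)" if "i < j" "j < n" for i j
    using assms(3)[unfolded standardizes_def, rule_format, of "Suc i" "Suc j"] that by simp
  have iff': "w ! j < w ! i \<longleftrightarrow> \<pi> (Suc j) < \<pi> (Suc i)" if "i < j" "j < n" for i j
  proof -
    have "\<pi> (Suc i) \<noteq> \<pi> (Suc j)" using that perms_inv(5)[OF assms(1)] by (auto dest: injD)
    then show ?thesis using iff[OF that] by auto
  qed
  have ball_Suc: "(\<forall>j\<in>{1..n}. P j) \<longleftrightarrow> (\<forall>j<n. P (Suc j))" for P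
    unfolding image_Suc_lessThan[symmetric] by auto
  show "lr_max 0 w = lmax n \<pi>"
    unfolding lmax_def card_perm_values[OF assms(1)] lr_max_eq_card len ball_Suc
    by (intro arg_cong[of _ _ card] Collect_cong conj_cong refl) (auto simp: iff)
  show "lr_min k w = lmin n \<pi>"
    unfolding lmin_def card_perm_values[OF assms(1)] lr_min_eq_card len ball_Suc
    by (intro arg_cong[of _ _ card] Collect_cong conj_cong refl) (auto simp: iff' lt)
  show "rl_max w = rmax n \<pi>"
    unfolding rmax_def card_perm_values[OF assms(1)] rl_max_eq_card len ball_Suc
    by (intro arg_cong[of _ _ card] Collect_cong conj_cong refl) (auto simp: iff')
qed

lemma ides_eq_card: "ides (Suc n) \<pi> = card {i. i < n \<and> inv \<pi> (Suc i) > inv \<pi> (Suc (Suc i))}"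
proof -
  have "{i \<in> {1..Suc n - 1}. inv \<pi> i > inv \<pi> (i + 1)}
    = Suc ` {i. i < n \<and> inv \<pi> (Suc i) > inv \<pi> (Suc (Suc i))}"
    by (auto simp: image_iff Bex_def) (metis One_nat_def Suc_le_eq Suc_pred)
  then show ?thesis by (simp add: ides_def des_def card_image)
qed

text \<open>The variable marks the alphabet size. Words are grouped by standardization: the weight
  is constant on a group, and the group is as large as the set of chains counted by
  \<open>chains_fps\<close>.\<close>

lemma words_ides_fps:
  fixes z q r :: "'a::field"
  shows "Abs_fps (\<lambda>k. \<Sum>w\<in>words (Suc n) k. word_wt z q r k w) * (1 - fps_X) ^ (n + 2)
    = (\<Sum>\<pi>\<in>perms (Suc n). fps_const (z ^ lmax (Suc n) \<pi> * q ^ lmin (Suc n) \<pi> * r ^ rmax (Suc n) \<pi>)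
        * fps_X ^ Suc (ides (Suc n) \<pi>))"
proof -
  let ?wt = "\<lambda>\<pi>. z ^ lmax (Suc n) \<pi> * q ^ lmin (Suc n) \<pi> * r ^ rmax (Suc n) \<pi>"
  let ?D = "\<lambda>\<pi> i. inv \<pi> (Suc i) > inv \<pi> (Suc (Suc i))"
  have "(\<Sum>w\<in>words (Suc n) k. word_wt z q r k w)
    = (\<Sum>\<pi>\<in>perms (Suc n). ?wt \<pi> * of_nat (card (chains (?D \<pi>) (Suc n) k)))" for k
    unfolding sum_words_standardize
  proof (intro sum.cong refl)
    fix \<pi> assume \<pi>: "\<pi> \<in> perms (Suc n)"
    have "(\<Sum>w\<in>{w \<in> words (Suc n) k. standardizes (Suc n) w \<pi>}. word_wt z q r k w)
      = (\<Sum>w\<in>{w \<in> words (Suc n) k. standardizes (Suc n) w \<pi>}. ?wt \<pi>)"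
      using lr_max_standardize[OF \<pi>] lr_min_standardize[OF \<pi>] rl_max_standardize[OF \<pi>]
      by (intro sum.cong refl) (auto simp: word_wt_def)
    then show "(\<Sum>w\<in>{w \<in> words (Suc n) k. standardizes (Suc n) w \<pi>}. word_wt z q r k w)
      = ?wt \<pi> * of_nat (card (chains (?D \<pi>) (Suc n) k))"
      by (simp add: card_words_standardize[OF \<pi>])
  qed
  then have "Abs_fps (\<lambda>k. \<Sum>w\<in>words (Suc n) k. word_wt z q r k w)
    = (\<Sum>\<pi>\<in>perms (Suc n). fps_const (?wt \<pi>) * Abs_fps (\<lambda>k. of_nat (card (chains (?D \<pi>) (Suc n) k))))"
    by (simp add: fps_eq_iff fps_sum_nth)
  then show ?thesis
    by (simp only: sum_distrib_right mult.assoc chains_fps ides_eq_card)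
qed

section \<open>Reflection in the antidiagonal\<close>

text \<open>The word sums are symmetric for every alphabet size, hence by
  \<open>words_ides_fps\<close> so is the series over permutations, in which the coefficient
  \<open>Suc d\<close> selects \<open>ides = d\<close>.\<close>

lemma sum_ides_swap:
  fixes z q r :: "'a::field"
  shows "(\<Sum>\<pi>\<in>{\<pi> \<in> perms (Suc n). ides (Suc n) \<pi> = d}.
      z ^ lmax (Suc n) \<pi> * q ^ lmin (Suc n) \<pi> * r ^ rmax (Suc n) \<pi>)
    = (\<Sum>\<pi>\<in>{\<pi> \<in> perms (Suc n). ides (Suc n) \<pi> = d}.
      z ^ lmax (Suc n) \<pi> * q ^ rmax (Suc n) \<pi> * r ^ lmin (Suc n) \<pi>)"
proof -
  let ?E = "\<lambda>q r. \<Sum>\<pi>\<in>perms (Suc n). fps_const (z ^ lmax (Suc n) \<pi> * q ^ lmin (Suc n) \<pi>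
    * r ^ rmax (Suc n) \<pi>) * fps_X ^ Suc (ides (Suc n) \<pi>)"
  have "(\<Sum>w\<in>words (Suc n) k. word_wt z q r k w) = (\<Sum>w\<in>words (Suc n) k. word_wt z r q k w)" for k
    using arg_cong[OF word_fps_commute[of z q r k], of "\<lambda>f. fps_nth f (Suc n)"]
    by (simp add: word_fps_def)
  then have "?E q r = ?E r q"
    by (simp only: flip: words_ides_fps)
  then have eq: "fps_nth (?E q r) (Suc d) = fps_nth (?E r q) (Suc d)"
    by simp
  have coeff: "fps_nth (?E q r) (Suc d) = (\<Sum>\<pi>\<in>{\<pi> \<in> perms (Suc n). ides (Suc n) \<pi> = d}.
      z ^ lmax (Suc n) \<pi> * q ^ lmin (Suc n) \<pi> * r ^ rmax (Suc n) \<pi>)" for q r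
  proof -
    have "fps_nth (?E q r) (Suc d) = (\<Sum>\<pi>\<in>perms (Suc n). if ides (Suc n) \<pi> = d then
        z ^ lmax (Suc n) \<pi> * q ^ lmin (Suc n) \<pi> * r ^ rmax (Suc n) \<pi> else 0)"
      unfolding fps_sum_nth
      by (intro sum.cong refl) (simp add: fps_X_power_iff del: power_Suc)
    then show ?thesis by (simp add: sum.inter_filter)
  qed
  show ?thesis
    using eq unfolding coeff by (simp only: mult.assoc mult.commute[of "r ^ _"])
qed

text \<open>
  With all values below \<open>N\<close>, the substitution \<open>(x, x ^ N, x ^ (N * N))\<close> encodes a triple as a base \<open>N\<close>
  number and reduces the claim to polynomials in one variable.
\<close>

lemma card_eq_if_power_sums_eq:
  fixes f g :: "'s \<Rightarrow> nat \<times> nat \<times> nat"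
  defines "wt \<equiv> \<lambda>x y z (a, b, c). x ^ a * y ^ b * z ^ c :: real"
  assumes "finite S" and sums: "\<And>x y z. (\<Sum>s\<in>S. wt x y z (f s)) = (\<Sum>s\<in>S. wt x y z (g s))"
  shows "card {s \<in> S. f s = v} = card {s \<in> S. g s = v}"
proof -
  define T where "T = insert v (f ` S \<union> g ` S)"
  have "finite T" using assms(2) by (simp add: T_def)
  then have "\<exists>N. \<forall>(a, b, c)\<in>T. a < N \<and> b < N \<and> c < N"
  proof (induction T rule: finite_induct)
    case (insert t T)
    then obtain N where N: "\<forall>(a, b, c)\<in>T. a < N \<and> b < N \<and> c < N" by blast
    obtain a b c where t: "t = (a, b, c)" by (cases t)
    show ?case
      using N by (intro exI[of _ "Suc (N + a + b + c)"]) (force simp: t)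
  qed simp
  then obtain N where N: "\<And>a b c. (a, b, c) \<in> T \<Longrightarrow> a < N \<and> b < N \<and> c < N" by fast
  define enc where "enc = (\<lambda>(a, b, c). a + N * (b + N * c))"
  have inj: "inj_on enc T"
  proof (rule inj_onI)
    fix s t assume st: "s \<in> T" "t \<in> T" "enc s = enc t"
    obtain a b c a' b' c' where eqs: "s = (a, b, c)" "t = (a', b', c')" by (cases s; cases t)
    have lt: "a < N" "b < N" "a' < N" "b' < N"
      using N st(1,2) eqs by blast+
    then have N0: "N \<noteq> 0" by simp
    have eq: "a + N * (b + N * c) = a' + N * (b' + N * c')"
      using st(3) by (simp add: enc_def eqs)
    have "a = a'" using arg_cong[OF eq, of "\<lambda>x. x mod N"] lt by simp
    moreover have eq': "b + N * c = b' + N * c'"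
      using eq N0 \<open>a = a'\<close> by simp
    moreover have "b = b'" using arg_cong[OF eq', of "\<lambda>x. x mod N"] lt by simp
    ultimately show "s = t" using N0 by (simp add: eqs)
  qed
  define P where "P h = (\<Sum>s\<in>S. monom 1 (enc (h s)) :: real poly)" for h
  have "poly (P h) x = (\<Sum>s\<in>S. wt x (x ^ N) (x ^ (N * N)) (h s))" for h x
    by (auto simp: P_def poly_sum poly_monom wt_def enc_def power_add power_mult algebra_simps
        intro!: sum.cong split: prod.splits simp flip: power_mult)
  then have "poly (P f) x = poly (P g) x" for x
    by (simp add: sums)
  then have PP: "P f = P g"
    by (simp add: poly_eq_poly_eq_iff[symmetric] fun_eq_iff)
  have coeff: "coeff (P h) (enc v) = real (card {s \<in> S. h s = v})" if "h ` S \<subseteq> T" for h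
  proof -
    have "coeff (P h) (enc v) = (\<Sum>s\<in>S. if h s = v then 1 else 0)"
      unfolding P_def coeff_sum
    proof (intro sum.cong refl)
      fix s assume "s \<in> S"
      with that have "h s \<in> T" "v \<in> T" by (auto simp: T_def)
      then show "coeff (monom 1 (enc (h s))) (enc v) = (if h s = v then 1 else (0::real))"
        using inj_on_eq_iff[OF inj] by simp
    qed
    then show ?thesis using assms(2) by (simp add: sum.inter_filter flip: sum.inter_filter)
  qed
  have "real (card {s \<in> S. f s = v}) = real (card {s \<in> S. g s = v})"
    unfolding coeff[of f, symmetric, unfolded T_def, OF subset_insertI2[OF Un_upper1]]
      coeff[of g, symmetric, unfolded T_def, OF subset_insertI2[OF Un_upper2]] PP ..
  then show ?thesis by simp
qed

lemma ides_lmin_rmax_symmetric: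
  assumes "n \<ge> 1"
  shows "card {\<pi> \<in> perms n. ides n \<pi> = d \<and> lmax n \<pi> = a \<and> lmin n \<pi> = b \<and> rmax n \<pi> = c}
    = card {\<pi> \<in> perms n. ides n \<pi> = d \<and> lmax n \<pi> = a \<and> rmax n \<pi> = b \<and> lmin n \<pi> = c}"
proof -
  obtain m where n: "n = Suc m" using assms by (cases n) auto
  have "card {\<pi> \<in> {\<pi> \<in> perms n. ides n \<pi> = d}. (lmax n \<pi>, lmin n \<pi>, rmax n \<pi>) = (a, b, c)}
    = card {\<pi> \<in> {\<pi> \<in> perms n. ides n \<pi> = d}. (lmax n \<pi>, rmax n \<pi>, lmin n \<pi>) = (a, b, c)}"
    by (rule card_eq_if_power_sums_eq) (simp_all add: n sum_ides_swap)
  then show ?thesis by (simp add: conj_assoc)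
qed

section \<open>The reflection and its effect on the statistics\<close>

definition rev_index :: "nat \<Rightarrow> nat \<Rightarrow> nat" where
  "rev_index n i = (if i \<in> {1..n} then n + 1 - i else i)"

lemma rev_index_rev_index [simp]: "rev_index n (rev_index n i) = i"
  by (auto simp: rev_index_def)

lemma rev_index_in_iff [simp]: "rev_index n i \<in> {1..n} \<longleftrightarrow> i \<in> {1..n}"
  by (auto simp: rev_index_def)

lemma rev_index_less_iff:
  "\<lbrakk>i \<in> {1..n}; j \<in> {1..n}\<rbrakk> \<Longrightarrow> rev_index n i < rev_index n j \<longleftrightarrow> j < i"
  by (auto simp: rev_index_def)

text \<open>For \<open>i\<close> in \<open>{1..n}\<close>, the point \<open>(i, \<pi> i)\<close> of
  the graph goes to \<open>(n + 1 - \<pi> i, n + 1 - i)\<close>.\<close>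

definition antidiag :: "nat \<Rightarrow> (nat \<Rightarrow> nat) \<Rightarrow> nat \<Rightarrow> nat" where
  "antidiag n \<pi> = rev_index n \<circ> inv \<pi> \<circ> rev_index n"

lemma rev_index_perms: "rev_index n \<in> perms n"
  unfolding perms_def mem_Collect_eq
proof (rule inj_imp_permutes)
  show "inj_on (rev_index n) {1..n}"
    by (rule inj_on_inverseI[of _ "rev_index n"]) simp
next
  fix x assume "x \<in> {1..n}"
  then show "rev_index n x \<in> {1..n}" by (simp only: rev_index_in_iff)
qed (auto simp: rev_index_def)

lemma
  assumes "\<pi> \<in> perms n"
  shows antidiag_perms: "antidiag n \<pi> \<in> perms n"
    and inv_antidiag: "inv (antidiag n \<pi>) = rev_index n \<circ> \<pi> \<circ> rev_index n"
    and antidiag_antidiag: "antidiag n (antidiag n \<pi>) = \<pi>"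
proof -
  show *: "antidiag n \<pi> \<in> perms n"
    using assms rev_index_perms[of n] unfolding antidiag_def perms_def mem_Collect_eq
    by (intro permutes_compose permutes_inv)
  show **: "inv (antidiag n \<pi>) = rev_index n \<circ> \<pi> \<circ> rev_index n"
    by (rule inv_unique_comp)
      (auto simp: antidiag_def fun_eq_iff perms_inv[OF assms])
  show "antidiag n (antidiag n \<pi>) = \<pi>"
    by (subst (1) antidiag_def) (simp add: ** fun_eq_iff)
qed

lemma card_perm_values_index:
  assumes "\<pi> \<in> perms n"
  shows "card {\<pi> i | i. i \<in> {1..n} \<and> P i} = card {i \<in> {1..n}. P i}"
proof -
  have "{\<pi> i | i. i \<in> {1..n} \<and> P i} = \<pi> ` {i \<in> {1..n}. P i}" by auto
  then show ?thesis
    using card_image[OF inj_on_subset[OF perms_inv(5)[OF assms] subset_UNIV]] by simp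
qed

text \<open>Substitute \<open>a = rev_index n (\<pi> i)\<close>, a bijection of positions; there the
  reflected permutation has the value \<open>rev_index n i\<close>. \<open>Q\<close> is arbitrary so
  that one lemma serves the three record statistics.\<close>

lemma card_antidiag:
  assumes "\<pi> \<in> perms n"
  shows "card {a \<in> {1..n}. \<forall>b\<in>{1..n}. Q a b (antidiag n \<pi> a) (antidiag n \<pi> b)}
    = card {i \<in> {1..n}. \<forall>j\<in>{1..n}.
        Q (rev_index n (\<pi> i)) (rev_index n (\<pi> j)) (rev_index n i) (rev_index n j)}"
proof -
  note p = perms_inv[OF assms]
  define h where "h i = rev_index n (\<pi> i)" for i
  have h: "antidiag n \<pi> (h i) = rev_index n i" for i
    by (simp add: h_def antidiag_def p)
  have "inj h"
    by (rule inj_on_inverseI[of _ "\<lambda>i. inv \<pi> (rev_index n i)"]) (simp add: h_def p)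
  have image: "h ` {1..n} = {1..n}"
  proof (intro equalityI subsetI)
    fix a assume "a \<in> {1..n}"
    then have "inv \<pi> (rev_index n a) \<in> {1..n}" by (intro p(4)) (simp only: rev_index_in_iff)
    then show "a \<in> h ` {1..n}" by (rule rev_image_eqI) (simp add: h_def p)
  next
    fix a assume "a \<in> h ` {1..n}"
    then obtain i where "i \<in> {1..n}" "a = h i" by blast
    with p(3) show "a \<in> {1..n}" by (simp only: h_def rev_index_in_iff)
  qed
  have "{a \<in> {1..n}. \<forall>b\<in>{1..n}. Q a b (antidiag n \<pi> a) (antidiag n \<pi> b)}
    = {a \<in> h ` {1..n}. \<forall>b\<in>h ` {1..n}. Q a b (antidiag n \<pi> a) (antidiag n \<pi> b)}"
    by (simp only: image)
  also have "\<dots> = h ` {i \<in> {1..n}. \<forall>j\<in>{1..n}. Q (h i) (h j) (rev_index n i) (rev_index n j)}"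
    by (auto simp: h)
  finally show ?thesis
    using card_image[OF inj_on_subset[OF \<open>inj h\<close> subset_UNIV]] by (simp add: h_def)
qed

lemma
  assumes "\<pi> \<in> perms n"
  shows lmax_antidiag: "lmax n (antidiag n \<pi>) = lmax n \<pi>"
    and lmin_antidiag: "lmin n (antidiag n \<pi>) = rmax n \<pi>"
    and rmax_antidiag: "rmax n (antidiag n \<pi>) = lmin n \<pi>"
    and ides_antidiag: "ides n (antidiag n \<pi>) = des n \<pi>"
proof -
  note p = perms_inv[OF assms]
  note less = rev_index_less_iff[OF p(3) p(3)] rev_index_less_iff
  have neq: "\<pi> i = \<pi> j \<longleftrightarrow> i = j" for i j using p(5) by (auto dest: injD)
  note vals = card_perm_values_index[OF antidiag_perms[OF assms]] card_perm_values_index[OF assms]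
  \<comment> \<open>After the substitution the condition says that every larger value stands further
    right, which is the contrapositive of being a left-to-right maximum. The other two cases are
    alike.\<close>
  show "lmax n (antidiag n \<pi>) = lmax n \<pi>"
    unfolding lmax_def vals card_antidiag[OF assms, of "\<lambda>a b x y. b < a \<longrightarrow> y < x"]
    by (intro arg_cong[of _ _ card] Collect_cong conj_cong refl ball_cong)
      (simp only: less, metis neq linorder_neqE_nat order_less_asym)
  show "lmin n (antidiag n \<pi>) = rmax n \<pi>"
    unfolding lmin_def rmax_def vals card_antidiag[OF assms, of "\<lambda>a b x y. b < a \<longrightarrow> x < y"]
    by (intro arg_cong[of _ _ card] Collect_cong conj_cong refl ball_cong)
      (simp only: less, metis neq linorder_neqE_nat order_less_asym)
  show "rmax n (antidiag n \<pi>) = lmin n \<pi>"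
    unfolding lmin_def rmax_def vals card_antidiag[OF assms, of "\<lambda>a b x y. b > a \<longrightarrow> y < x"]
    by (intro arg_cong[of _ _ card] Collect_cong conj_cong refl ball_cong)
      (simp only: less, metis neq linorder_neqE_nat order_less_asym)
  \<comment> \<open>The inverse of the reflection is the reverse-complement of \<open>\<pi>\<close>,
    which moves a descent at \<open>j\<close> to \<open>n - j\<close>.\<close>
  have "{i \<in> {1..n - 1}. inv (antidiag n \<pi>) i > inv (antidiag n \<pi>) (i + 1)}
    = (\<lambda>i. n - i) ` {i \<in> {1..n - 1}. \<pi> i > \<pi> (i + 1)}" (is "?L = ?R")
  proof -
    have *: "inv (antidiag n \<pi>) i > inv (antidiag n \<pi>) (i + 1) \<longleftrightarrow> \<pi> (n - i) > \<pi> (n - i + 1)"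
      if "i \<in> {1..n - 1}" for i
    proof -
      have "rev_index n i = n - i + 1" "rev_index n (i + 1) = n - i"
        using that by (auto simp: rev_index_def)
      moreover have "n - i + 1 \<in> {1..n}" "n - i \<in> {1..n}" using that by auto
      ultimately show ?thesis
        by (simp only: inv_antidiag[OF assms] o_apply less)
    qed
    show ?thesis
    proof (intro equalityI subsetI)
      fix i assume "i \<in> ?L"
      then have i: "i \<in> {1..n - 1}" "\<pi> (n - i) > \<pi> (n - i + 1)" using * by auto
      then show "i \<in> ?R" by (intro image_eqI[of _ _ "n - i"]) auto
    next
      fix i assume "i \<in> ?R"
      then obtain j where j: "i = n - j" "j \<in> {1..n - 1}" "\<pi> j > \<pi> (j + 1)" by auto
      then have "i \<in> {1..n - 1}" "n - i = j" by auto
      with j * show "i \<in> ?L" by simp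
    qed
  qed
  moreover have "inj_on (\<lambda>i. n - i) {i \<in> {1..n - 1}. \<pi> i > \<pi> (i + 1)}"
    by (auto simp: inj_on_def)
  ultimately show "ides n (antidiag n \<pi>) = des n \<pi>"
    by (simp add: ides_def des_def card_image)
qed

text \<open>\<open>antidiag\<close> turns \<open>(des, lmax, lmin, rmax)\<close> into
  \<open>(ides, lmax, rmax, lmin)\<close>; \<open>ides_lmin_rmax_symmetric\<close> puts the last two
  back in order.\<close>

lemma des_ides_same_distribution:
  assumes "n \<ge> 1"
  shows "same_distribution_on (perms n)
    (\<lambda>\<pi>. (des n \<pi>, lmax n \<pi>, lmin n \<pi>, rmax n \<pi>))
    (\<lambda>\<pi>. (ides n \<pi>, lmax n \<pi>, lmin n \<pi>, rmax n \<pi>))"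
  unfolding same_distribution_on_def
proof
  fix v :: "nat \<times> nat \<times> nat \<times> nat"
  obtain d a b c where v: "v = (d, a, b, c)" by (cases v)
  have "bij_betw (antidiag n)
    {\<pi> \<in> perms n. des n \<pi> = d \<and> lmax n \<pi> = a \<and> lmin n \<pi> = b \<and> rmax n \<pi> = c}
    {\<pi> \<in> perms n. ides n \<pi> = d \<and> lmax n \<pi> = a \<and> rmax n \<pi> = b \<and> lmin n \<pi> = c}"
  proof (rule bij_betw_byWitness[where f' = "antidiag n"])
    show "antidiag n ` {\<pi> \<in> perms n. ides n \<pi> = d \<and> lmax n \<pi> = a \<and> rmax n \<pi> = b \<and> lmin n \<pi> = c}
      \<subseteq> {\<pi> \<in> perms n. des n \<pi> = d \<and> lmax n \<pi> = a \<and> lmin n \<pi> = b \<and> rmax n \<pi> = c}"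
      using ides_antidiag[OF antidiag_perms]
      by (auto simp: antidiag_perms lmax_antidiag lmin_antidiag rmax_antidiag antidiag_antidiag)
  qed (auto simp: antidiag_perms lmax_antidiag lmin_antidiag rmax_antidiag ides_antidiag antidiag_antidiag)
  from bij_betw_same_card[OF this]
  show "card {\<pi> \<in> perms n. (des n \<pi>, lmax n \<pi>, lmin n \<pi>, rmax n \<pi>) = v}
    = card {\<pi> \<in> perms n. (ides n \<pi>, lmax n \<pi>, lmin n \<pi>, rmax n \<pi>) = v}"
    by (simp add: v ides_lmin_rmax_symmetric[OF assms])
qed

section \<open>The generating function\<close>

text \<open>This is \<open>words_ides_fps\<close> at \<open>r = 1\<close>. The word sum over
  \<open>Suc k\<close> letters is a partial sum of \<open>span_sum\<close>, which uses up one factor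
  \<open>1 - fps_X\<close> and produces the \<open>fps_X\<close> that cancels.\<close>

lemma ides_fps:
  fixes z q :: "'a::field"
  shows "(\<Sum>\<pi>\<in>perms (Suc n). fps_const (z ^ lmax (Suc n) \<pi> * q ^ lmin (Suc n) \<pi>) * fps_X ^ ides (Suc n) \<pi>)
    = Abs_fps (span_sum z q n) * (1 - fps_X) ^ Suc n" (is "?E = ?S * _")
proof -
  let ?W = "Abs_fps (\<lambda>k. \<Sum>w\<in>words (Suc n) k. word_wt z q 1 k w)"
  have W: "?W * (1 - fps_X) = fps_X * ?S"
  proof (rule fps_ext)
    fix k
    have "words (Suc n) 0 = {}" by (auto simp: words_def)
    moreover have "(\<Sum>w\<in>words (Suc n) (Suc k). word_wt z q 1 (Suc k) w) = (\<Sum>l\<le>k. span_sum z q n l)" for k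
      by (simp add: word_wt_def sum_words_head_wt flip: head_wt_def)
    ultimately show "fps_nth (?W * (1 - fps_X)) k = fps_nth (fps_X * ?S) k"
      by (cases k; cases "k - 1") (simp_all add: right_diff_distrib)
  qed
  have "fps_X * ?E = ?W * (1 - fps_X) ^ (n + 2)"
    unfolding words_ides_fps by (simp add: sum_distrib_left mult_ac)
  also have "\<dots> = fps_X * (?S * (1 - fps_X) ^ Suc n)"
    using arg_cong[OF W, of "\<lambda>f. f * (1 - fps_X) ^ Suc n"] by (simp add: mult.assoc)
  finally show ?thesis by simp
qed

text \<open>The coefficients are themselves series and do not form a field; the divisor is a unit
  because its constant coefficient is 1.\<close>

lemma divide_one_minus_fps_X_power:
  fixes f :: "'a::field fps fps"
  shows "f / (1 - fps_X) ^ n * (1 - fps_X) ^ n = f"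
proof -
  let ?g = "(1 - fps_X) ^ n :: 'a fps fps"
  have g: "fps_nth ?g 0 = 1" by (simp add: fps_nth_power_0)
  then have "?g * inverse ?g = 1"
    unfolding fps_inverse_def by (intro fps_right_inverse) simp
  moreover have "f / ?g = f * inverse ?g"
    using g by (intro fps_divide_unit) simp
  ultimately show ?thesis by (simp add: mult_ac)
qed

text \<open>Carries an identity in \<open>u\<close> with scalar coefficients over to outer series;
  in the application \<open>c\<close> is a power of \<open>t\<close>.\<close>

lemma lift_one_minus_fps_X_power:
  fixes f :: "'a::comm_ring_1 fps" and c :: "'a fps"
  shows "Abs_fps (\<lambda>i. fps_const (fps_nth (f * (1 - fps_X) ^ m) i) * c)
    = Abs_fps (\<lambda>i. fps_const (fps_nth f i) * c) * (1 - fps_X) ^ m"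
proof (induction m)
  case (Suc m)
  have "Abs_fps (\<lambda>i. fps_const (fps_nth (g * (1 - fps_X)) i) * c)
    = Abs_fps (\<lambda>i. fps_const (fps_nth g i) * c) * (1 - fps_X)" for g :: "'a fps"
  proof (rule fps_ext)
    fix i
    show "fps_nth (Abs_fps (\<lambda>i. fps_const (fps_nth (g * (1 - fps_X)) i) * c)) i
      = fps_nth (Abs_fps (\<lambda>i. fps_const (fps_nth g i) * c) * (1 - fps_X)) i"
      by (cases i) (simp_all add: right_diff_distrib left_diff_distrib flip: fps_const_sub)
  qed
  from this[of "f * (1 - fps_X) ^ m"] Suc show ?case
    by (simp add: mult_ac)
qed simp

lemma ides_term:
  fixes z q :: "'a::field"
  shows "(\<Sum>\<pi>\<in>perms (Suc n). fps_X ^ ides (Suc n) \<pi> *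
      fps_const (fps_const (z ^ lmax (Suc n) \<pi> * q ^ lmin (Suc n) \<pi>) * fps_X ^ Suc n) / (1 - fps_X) ^ Suc n)
    = Abs_fps (\<lambda>i. fps_const (span_sum z q n i) * fps_X ^ Suc n)" (is "?L = ?R")
proof -
  let ?wt = "\<lambda>\<pi>. z ^ lmax (Suc n) \<pi> * q ^ lmin (Suc n) \<pi>"
  have "?L * (1 - fps_X) ^ Suc n
    = (\<Sum>\<pi>\<in>perms (Suc n). fps_X ^ ides (Suc n) \<pi> * fps_const (fps_const (?wt \<pi>) * fps_X ^ Suc n))"
    unfolding sum_distrib_right divide_one_minus_fps_X_power ..
  also have "\<dots> = Abs_fps (\<lambda>i. fps_const (fps_nth
      (\<Sum>\<pi>\<in>perms (Suc n). fps_const (?wt \<pi>) * fps_X ^ ides (Suc n) \<pi>) i) * fps_X ^ Suc n)"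
  proof (rule fps_ext)
    fix i
    have "fps_const (fps_nth (\<Sum>\<pi>\<in>perms (Suc n). fps_const (?wt \<pi>) * fps_X ^ ides (Suc n) \<pi>) i)
      = (\<Sum>\<pi>\<in>perms (Suc n). fps_const (if ides (Suc n) \<pi> = i then ?wt \<pi> else 0))"
      by (auto simp: fps_eq_iff fps_sum_nth fps_X_power_iff intro!: sum.cong)
    then show "fps_nth (\<Sum>\<pi>\<in>perms (Suc n). fps_X ^ ides (Suc n) \<pi> *
        fps_const (fps_const (?wt \<pi>) * fps_X ^ Suc n)) i
      = fps_nth (Abs_fps (\<lambda>i. fps_const (fps_nth
      (\<Sum>\<pi>\<in>perms (Suc n). fps_const (?wt \<pi>) * fps_X ^ ides (Suc n) \<pi>) i) * fps_X ^ Suc n)) i"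
      by (auto simp: fps_sum_nth sum_distrib_right fps_X_power_iff simp del: power_Suc intro!: sum.cong)
  qed
  also have "\<dots> = ?R * (1 - fps_X) ^ Suc n"
    unfolding ides_fps lift_one_minus_fps_X_power by simp
  finally have "?L * (1 - fps_X) ^ Suc n = ?R * (1 - fps_X) ^ Suc n" .
  moreover have "(1 - fps_X :: 'a fps fps) \<noteq> 0"
    by (rule notI, drule arg_cong[of _ _ "\<lambda>f. fps_nth f 0"]) simp
  ultimately show ?thesis by simp
qed

lemma sum_eq_if_same_distribution:
  fixes h :: "'v \<Rightarrow> 'b::semiring_1"
  assumes "finite S" "same_distribution_on S f g"
  shows "(\<Sum>x\<in>S. h (f x)) = (\<Sum>x\<in>S. h (g x))"
proof -
  have *: "(\<Sum>x\<in>S. h (k x)) = (\<Sum>v\<in>f ` S \<union> g ` S. of_nat (card {x \<in> S. k x = v}) * h v)"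
    if "k ` S \<subseteq> f ` S \<union> g ` S" for k
  proof -
    have "(\<Sum>x\<in>S. h (k x)) = (\<Sum>v\<in>f ` S \<union> g ` S. \<Sum>x\<in>{x \<in> S. k x = v}. h (k x))"
      using assms(1) that by (intro sum.group[symmetric]) auto
    then show ?thesis by simp
  qed
  show ?thesis
    using assms(2) by (simp add: *[of f] *[of g] same_distribution_on_def)
qed

text \<open>The denominator of the prefactor cancels the numerator factor with \<open>i = n\<close>;
  the remaining ones, \<open>i < n\<close>, form \<open>shift_prod q n\<close> with
  \<open>j = i + 1\<close>.\<close>

lemma head_fps_eq_quotient:
  fixes z q :: "'a::field"
  shows "fps_const (q * z) * fps_X / (1 - fps_const (of_nat n - q + 1) * fps_X) *
      (\<Prod>i = 0..n. (1 - fps_const (of_nat i - q + 1) * fps_X) /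
                   (1 - fps_const (of_nat i + z) * fps_X)) = head_fps z q n"
proof -
  define a where "a i = 1 - fps_const (of_nat i - q + 1) * fps_X" for i
  define b where "b i = 1 - fps_const (of_nat i + z) * fps_X" for i
  have ab: "fps_nth (a i) 0 \<noteq> 0" "fps_nth (b i) 0 \<noteq> 0" for i
    by (simp_all add: a_def b_def)
  have "shift_prod q n = (\<Prod>i<n. a i)"
  proof (induction n)
    case (Suc n)
    have "1 + (fps_const q - of_nat (Suc n)) * fps_X = a n"
      by (simp add: a_def algebra_simps flip: fps_of_nat fps_const_sub fps_const_add)
    with Suc show ?case by (simp add: shift_prod_Suc)
  qed simp
  then have closed: "head_fps z q n * (\<Prod>i\<le>n. b i) = fps_const (q * z) * fps_X * (\<Prod>i<n. a i)"
    using head_fps_closed[of z q n] by (simp add: b_def)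
  have "fps_const (q * z) * fps_X / a n * (\<Prod>i\<le>n. a i / b i)
    = fps_const (q * z) * fps_X * inverse (a n) * ((\<Prod>i\<le>n. a i) * inverse (\<Prod>i\<le>n. b i))"
    by (simp add: fps_divide_unit ab prod.distrib inverse_prod_fps)
  also have "\<dots> = fps_const (q * z) * fps_X * (\<Prod>i<n. a i) * (a n * inverse (a n)) * inverse (\<Prod>i\<le>n. b i)"
    by (simp add: mult_ac flip: lessThan_Suc_atMost)
  also have "\<dots> = head_fps z q n * ((\<Prod>i\<le>n. b i) * inverse (\<Prod>i\<le>n. b i))"
    unfolding inverse_mult_eq_1'[OF ab(1)] by (simp only: mult_1_right closed flip: mult.assoc)
  also have "(\<Prod>i\<le>n. b i) * inverse (\<Prod>i\<le>n. b i) = (\<Prod>i\<le>n. b i * inverse (b i))"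
    by (simp add: inverse_prod_fps prod.distrib)
  also have "\<dots> = 1"
    by (simp add: inverse_mult_eq_1'[OF ab(2)])
  finally show ?thesis by (simp add: a_def b_def atLeast0AtMost)
qed

text \<open>The member of index \<open>n\<close> is homogeneous of degree \<open>n\<close> in
  \<open>t\<close>, so the power \<open>t ^ j\<close> occurs only in member
  \<open>j\<close>.\<close>

lemma has_formal_sum_t_homogeneous:
  fixes f :: "nat \<Rightarrow> 'a::field fps fps"
  assumes "\<And>n. f (Suc n) = Abs_fps (\<lambda>i. fps_const (span_sum z q n i) * fps_X ^ Suc n)"
  shows "has_formal_sum f {1..} (Abs_fps (head_fps z q))"
  unfolding has_formal_sum_def
proof (intro allI conjI)
  fix i j
  have nth: "fps_nth (fps_nth (f n) i) j = (if n = j then fps_nth (head_fps z q i) j else 0)"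
    if "n \<ge> 1" for n
    using that assms[of "n - 1"] by (cases n) (auto simp: fps_X_power_iff head_fps_def simp del: power_Suc)
  have sub: "{n \<in> {1..}. fps_nth (fps_nth (f n) i) j \<noteq> 0} \<subseteq> {j}"
    using nth by (auto split: if_splits)
  then show "finite {n \<in> {1..}. fps_nth (fps_nth (f n) i) j \<noteq> 0}"
    by (rule finite_subset) simp
  have zero: "fps_nth (head_fps z q i) 0 = 0"
    by (simp add: head_fps_def)
  \<comment> \<open>Removing 0 covers \<open>j = 0\<close>: index 0 is outside the family, and
    \<open>head_fps\<close> has no constant term.\<close>
  have "(\<Sum>n\<in>{n \<in> {1..}. fps_nth (fps_nth (f n) i) j \<noteq> 0}. fps_nth (fps_nth (f n) i) j)
    = (\<Sum>n\<in>{j} - {0}. fps_nth (fps_nth (f n) i) j)"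
    using sub by (intro sum.mono_neutral_left) auto
  also have "\<dots> = fps_nth (head_fps z q i) j"
    using nth[of j] zero by (cases "j = 0") simp_all
  finally show "fps_nth (fps_nth (Abs_fps (head_fps z q)) i) j
    = (\<Sum>n\<in>{n \<in> {1..}. fps_nth (fps_nth (f n) i) j \<noteq> 0}. fps_nth (fps_nth (f n) i) j)"
    by simp
qed

lemma has_formal_sum_u_homogeneous:
  fixes h :: "nat \<Rightarrow> 'a::comm_ring_1 fps"
  shows "has_formal_sum (\<lambda>n. fps_const (h n) * fps_X ^ n) {0..} (Abs_fps h)"
  unfolding has_formal_sum_def
proof (intro allI conjI)
  fix i j
  have nth: "fps_nth (fps_nth (fps_const (h n) * fps_X ^ n) i) j = (if n = i then fps_nth (h i) j else 0)" for n
    by (simp add: fps_X_power_iff)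
  have set: "{n \<in> {0..}. fps_nth (fps_nth (fps_const (h n) * fps_X ^ n) i) j \<noteq> 0}
    = (if fps_nth (h i) j = 0 then {} else {i})"
    unfolding nth by auto
  show "finite {n \<in> {0..}. fps_nth (fps_nth (fps_const (h n) * fps_X ^ n) i) j \<noteq> 0}"
    unfolding set by simp
  show "fps_nth (fps_nth (Abs_fps h) i) j
    = (\<Sum>n\<in>{n \<in> {0..}. fps_nth (fps_nth (fps_const (h n) * fps_X ^ n) i) j \<noteq> 0}.
        fps_nth (fps_nth (fps_const (h n) * fps_X ^ n) i) j)"
    unfolding set unfolding nth by simp
qed

theorem theorem5:
  fixes z q :: "'a::field"
  shows "(\<exists>F :: 'a fps fps.
      has_formal_sum
        (\<lambda>n. \<Sum>\<pi> \<in> perms n.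
           fps_X ^ des n \<pi> *
           fps_const (fps_const (z ^ lmax n \<pi> * q ^ lmin n \<pi>) * fps_X ^ n) / (1 - fps_X) ^ n)
        {1..} F \<and>
      has_formal_sum
        (\<lambda>n. \<Sum>\<pi> \<in> perms n.
           fps_X ^ ides n \<pi> *
           fps_const (fps_const (z ^ lmax n \<pi> * q ^ lmin n \<pi>) * fps_X ^ n) / (1 - fps_X) ^ n)
        {1..} F \<and>
      has_formal_sum
        (\<lambda>n. fps_const
             (fps_const (q * z) * fps_X / (1 - fps_const (of_nat n - q + 1) * fps_X) *
              (\<Prod>i = 0..n. (1 - fps_const (of_nat i - q + 1) * fps_X) /
                           (1 - fps_const (of_nat i + z) * fps_X))) *
           fps_X ^ n)
        {0..} F) \<and>
    (\<forall>n \<ge> 1. same_distribution_on (perms n)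
       (\<lambda>\<pi>. (des n \<pi>, lmax n \<pi>, lmin n \<pi>, rmax n \<pi>))
       (\<lambda>\<pi>. (ides n \<pi>, lmax n \<pi>, lmin n \<pi>, rmax n \<pi>)))"
proof (intro conjI allI impI exI[of _ "Abs_fps (head_fps z q)"])
  let ?term = "\<lambda>s n. \<Sum>\<pi>\<in>perms n. fps_X ^ s n \<pi> *
    fps_const (fps_const (z ^ lmax n \<pi> * q ^ lmin n \<pi>) * fps_X ^ n) / (1 - fps_X) ^ n"
  show "has_formal_sum (?term ides) {1..} (Abs_fps (head_fps z q))"
    by (rule has_formal_sum_t_homogeneous) (rule ides_term)
  \<comment> \<open>The summand is a function of the quadruple that ignores \<open>rmax\<close>, so
    equidistribution equates the two families term by term.\<close>
  have "?term des (Suc n) = ?term ides (Suc n)" for n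
    using sum_eq_if_same_distribution[OF finite_perms des_ides_same_distribution[of "Suc n"],
        of "\<lambda>(d, a, b, c). fps_X ^ d *
          fps_const (fps_const (z ^ a * q ^ b) * fps_X ^ Suc n) / (1 - fps_X) ^ Suc n"]
    by simp
  then show "has_formal_sum (?term des) {1..} (Abs_fps (head_fps z q))"
    by (intro has_formal_sum_t_homogeneous) (simp only: ides_term)
  show "has_formal_sum (\<lambda>n. fps_const (fps_const (q * z) * fps_X / (1 - fps_const (of_nat n - q + 1) * fps_X) *
              (\<Prod>i = 0..n. (1 - fps_const (of_nat i - q + 1) * fps_X) /
                           (1 - fps_const (of_nat i + z) * fps_X))) * fps_X ^ n)
    {0..} (Abs_fps (head_fps z q))"
    unfolding head_fps_eq_quotient by (rule has_formal_sum_u_homogeneous)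
qed (rule des_ides_same_distribution)

end
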